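(* Let $F(x)=\sum_{i=1}^n\phi_i(a_i^\top x)$ on $\mathbb{R}^d$, where each $\phi_i:\mathbb{R}\to\mathbb{R}$ is convex and $L$-smooth, $F$ is $\mu$-strongly convex, $R=\max_i\|a_i\|_2$ and $\kappa=\lceil LR^2/\mu\rceil$. Instantiating Dual APPA with APCG as the dual oracle and $\lambda=\mu$ yields an algorithm that, from an initial point $x^{(0)}$ with error $\epsilon_0=F(x^{(0)})-\min F$, computes $x$ with $\mathbb{E}F(x)-\min F\le\epsilon$ in running time $$\tilde O\big(nd\sqrt\kappa\,\log(\epsilon_0/\epsilon)\big).$$
   Context: $A\in\mathbb{R}^{n\times d}$ is the matrix with rows $a_i^\top$, $\kappa_\lambda=\lceil LR^2/\lambda\rceil$. $L$-smooth: $\phi(y)\le\phi(x)+\phi'(x)(y-x)+\frac L2(y-x)^2$ for all $x,y$. With $\phi_i^*$ the Fenchel conjugate, $g_{s,\lambda}(y)=\sum_{i=1}^n\phi_i^*(y_i)+\frac1{2\lambda}\|A^\top y\|_2^2-s^\top A^\top y$ for $s\in\mathbb{R}^d$, $y\in\mathbb{R}^n$. Dual-to-primal map: $\hat x_{s,\lambda}(y)=s-\frac1\lambda A^\top y$; primal-to-dual map: $[\hat y(x)]_i=\phi_i'(a_i^\top x)$. A dual $(c,\lambda)$-oracle is an algorithm $\mathcal{D}$ that, given $s\in\mathbb{R}^d$ and $y\in\mathbb{R}^n$, outputs $\mathcal{D}(s,y)$ with $\mathbb{E}g_{s,\lambda}(\mathcal{D}(s,y))-\min g_{s,\lambda}\le\frac1c[g_{s,\lambda}(y)-\min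 g_{s,\lambda}]$. Dual APPA: input $x^{(0)}\in\mathbb{R}^d$, $\lambda>0$, and a dual $(\sigma,\lambda)$-oracle $\mathcal{D}$ with $\sigma\ge80n^2\kappa_\lambda^2\max\{\kappa,\kappa_\lambda\}\lceil\lambda/\mu\rceil$; set $y^{(0)}=\hat y(x^{(0)})$; for $t=1,\dots,T$ set $y^{(t)}=\mathcal{D}(x^{(t-1)},y^{(t-1)})$ and $x^{(t)}=\hat x_{x^{(t-1)},\lambda}(y^{(t)})$; output $x^{(T)}$. Known fact taken as given: APCG (accelerated proximal coordinate gradient, Lin, Lu and Xiao 2014) is a randomized dual $(c,\lambda)$-oracle with running time $\tilde O(nd\sqrt{\kappa_\lambda}\log c)$. Computational model: for any $i$ and $x\in\mathbb{R}^d$, evaluating $\phi_i(a_i^\top x)$, computing the gradient of $x\mapsto\phi_i(a_i^\top x-b)$ ($b\in\mathbb{R}$), and minimizing $\phi_i(a_i^\top x)+b\|x-c\|_2^2$ ($b\in\mathbb{R}$, $c\in\mathbb{R}^d$) each take $O(d)$ time. $\tilde O(\cdot)$ hides factors polylogarithmic in $n,L,\mu,\lambda,R$; $\log(\epsilon_0/\epsilon)$ is read as $\max\{1,\log(\epsilon_0/\epsilon)\}$. *)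

theory Defs
  imports "HOL-Probability.Probability" "Jordan_Normal_Form.Matrix"
begin

(* HOL-Analysis uses the same symbols for its type-indexed vectors. *)
no_notation inner (infix \<open>\<bullet>\<close> 70)
no_notation vec_nth (infixl \<open>$\<close> 90)
hide_type (open) Finite_Cartesian_Product.vec

(* The running-time constants must be uniform in n and d, so both dimensions are values, not types:
   x \<in> carrier_vec d, y \<in> carrier_vec n, and the rows of the n x d matrix data are the a_i. *)
record erm =
  data :: "real mat"
  loss :: "nat \<Rightarrow> real \<Rightarrow> real"
  smoothness :: real
  strong_convexity :: real

abbreviation n_of :: "erm \<Rightarrow> nat" where "n_of P \<equiv> dim_row (data P)"
abbreviation d_of :: "erm \<Rightarrow> nat" where "d_of P \<equiv> dim_col (data P)"

definition vnorm :: "real vec \<Rightarrow> real" where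
  "vnorm v = sqrt (v \<bullet> v)"

definition objective :: "erm \<Rightarrow> real vec \<Rightarrow> real" where
  "objective P x = (\<Sum>i<n_of P. loss P i (row (data P) i \<bullet> x))"

(* A genuine minimum under erm_problem: F is continuous and strongly convex. *)
definition min_objective :: "erm \<Rightarrow> real" where
  "min_objective P = (INF x\<in>carrier_vec (d_of P). objective P x)"

definition L_smooth :: "real \<Rightarrow> (real \<Rightarrow> real) \<Rightarrow> bool" where
  "L_smooth L \<phi> \<longleftrightarrow> (\<forall>x. \<phi> differentiable at x) \<and>
     (\<forall>x y. \<phi> y \<le> \<phi> x + deriv \<phi> x * (y - x) + L / 2 * (y - x)\<^sup>2)"

definition strongly_convex :: "real \<Rightarrow> nat \<Rightarrow> (real vec \<Rightarrow> real) \<Rightarrow> bool" where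
  "strongly_convex \<mu> d f \<longleftrightarrow>
     (\<forall>x\<in>carrier_vec d. \<forall>y\<in>carrier_vec d. \<forall>t\<in>{0..1}.
        f ((1 - t) \<cdot>\<^sub>v x + t \<cdot>\<^sub>v y)
          \<le> (1 - t) * f x + t * f y - \<mu> / 2 * t * (1 - t) * (vnorm (x - y))\<^sup>2)"

definition erm_problem :: "erm \<Rightarrow> bool" where
  "erm_problem P \<longleftrightarrow> 1 \<le> n_of P \<and> 1 \<le> d_of P \<and> 0 < smoothness P \<and> 0 < strong_convexity P \<and>
     (\<forall>i<n_of P. convex_on UNIV (loss P i) \<and> L_smooth (smoothness P) (loss P i)) \<and>
     strongly_convex (strong_convexity P) (d_of P) (objective P)"

definition radius :: "erm \<Rightarrow> real" where
  "radius P = Max ((\<lambda>i. vnorm (row (data P) i)) ` {..<n_of P})"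

definition kappa_reg :: "erm \<Rightarrow> real \<Rightarrow> int" where
  "kappa_reg P lam = \<lceil>smoothness P * (radius P)\<^sup>2 / lam\<rceil>"

definition kappa :: "erm \<Rightarrow> int" where
  "kappa P = \<lceil>smoothness P * (radius P)\<^sup>2 / strong_convexity P\<rceil>"

definition fenchel_conjugate :: "(real \<Rightarrow> real) \<Rightarrow> real \<Rightarrow> ereal" where
  "fenchel_conjugate \<phi> y = (SUP x. ereal (x * y - \<phi> x))"

definition dual_objective :: "erm \<Rightarrow> real vec \<Rightarrow> real \<Rightarrow> real vec \<Rightarrow> ereal" where
  "dual_objective P s lam y =
     (\<Sum>i<n_of P. fenchel_conjugate (loss P i) (y $ i)) +
     ereal (1 / (2 * lam) * (vnorm ((data P)\<^sup>T *\<^sub>v y))\<^sup>2 - s \<bullet> ((data P)\<^sup>T *\<^sub>v y))"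

(* g(y) - min g. The minimum is finite but g may take the value \<infinity>; since the gap is nonnegative,
   its expectation is taken as a nonnegative integral. *)
definition dual_gap :: "erm \<Rightarrow> real vec \<Rightarrow> real \<Rightarrow> real vec \<Rightarrow> ennreal" where
  "dual_gap P s lam y =
     e2ennreal (dual_objective P s lam y - (INF z\<in>carrier_vec (n_of P). dual_objective P s lam z))"

definition dual_to_primal :: "erm \<Rightarrow> real vec \<Rightarrow> real \<Rightarrow> real vec \<Rightarrow> real vec" where
  "dual_to_primal P s lam y = s - (1 / lam) \<cdot>\<^sub>v ((data P)\<^sup>T *\<^sub>v y)"

definition primal_to_dual :: "erm \<Rightarrow> real vec \<Rightarrow> real vec" where
  "primal_to_dual P x = vec (n_of P) (\<lambda>i. deriv (loss P i) (row (data P) i \<bullet> x))"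

(* A randomized computation: joint law of the result and the number of steps spent on it. *)
type_synonym 'a timed = "('a \<times> nat) pmf"

definition dual_oracle ::
  "erm \<Rightarrow> real \<Rightarrow> real \<Rightarrow> (real vec \<Rightarrow> real vec \<Rightarrow> real vec timed) \<Rightarrow> bool" where
  "dual_oracle P c lam D \<longleftrightarrow>
     (\<forall>s\<in>carrier_vec (d_of P). \<forall>y\<in>carrier_vec (n_of P).
        fst ` set_pmf (D s y) \<subseteq> carrier_vec (n_of P) \<and>
        (\<integral>\<^sup>+ r. dual_gap P s lam (fst r) \<partial>measure_pmf (D s y))
          \<le> ennreal (1 / c) * dual_gap P s lam y)"

(* State (x^(t), y^(t)) of Dual APPA together with the time spent so far. A scalar operation costs 1
   and a loss primitive costs prim_time d. The primal-to-dual map needs the n derivatives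
   \<phi>_i'(a_i^T x). The dual-to-primal map needs 2nd operations for A^T y, 2d for scaling and
   subtracting, and 1 for 1/\<lambda>. *)
primrec dual_appa_state ::
  "(nat \<Rightarrow> nat) \<Rightarrow> erm \<Rightarrow> real \<Rightarrow> (real vec \<Rightarrow> real vec \<Rightarrow> real vec timed) \<Rightarrow> real vec \<Rightarrow>
     nat \<Rightarrow> (real vec \<times> real vec) timed" where
  "dual_appa_state prim_time P lam D x0 0 =
     return_pmf ((x0, primal_to_dual P x0), n_of P * prim_time (d_of P))"
| "dual_appa_state prim_time P lam D x0 (Suc t) =
     do {
       ((x, y), k) \<leftarrow> dual_appa_state prim_time P lam D x0 t;
       (y', k') \<leftarrow> D x y;
       return_pmf ((dual_to_primal P x lam y', y'), k + k' + (2 * n_of P * d_of P + 2 * d_of P + 1))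
     }"

definition dual_appa ::
  "(nat \<Rightarrow> nat) \<Rightarrow> erm \<Rightarrow> real \<Rightarrow> (real vec \<Rightarrow> real vec \<Rightarrow> real vec timed) \<Rightarrow> real vec \<Rightarrow>
     nat \<Rightarrow> real vec timed" where
  "dual_appa prim_time P lam D x0 T =
     map_pmf (\<lambda>((x, y), k). (x, k)) (dual_appa_state prim_time P lam D x0 T)"

(* The least oracle quality that Dual APPA admits. *)
definition appa_sigma :: "erm \<Rightarrow> real \<Rightarrow> real" where
  "appa_sigma P lam = 80 * real (n_of P) ^ 2 * of_int (kappa_reg P lam) ^ 2 *
     of_int (max (kappa P) (kappa_reg P lam)) * of_int \<lceil>lam / strong_convexity P\<rceil>"

(* Powers of this quantity are the factors hidden by soft-O. *)
definition polylog_base :: "erm \<Rightarrow> real \<Rightarrow> real" where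
  "polylog_base P lam = 1 + ln (n_of P) + \<bar>ln (smoothness P)\<bar> + \<bar>ln (strong_convexity P)\<bar> +
     \<bar>ln lam\<bar> + \<bar>ln (radius P)\<bar>"

(* log x is read as max {1, log x}. *)
definition log1 :: "real \<Rightarrow> real" where
  "log1 x = max 1 (ln x)"

(* The properties of APCG (Lin, Lu and Xiao 2014) used as a black box. The arguments of the
   algorithm are the problem, the quality c, \<lambda>, the centre s and the starting point y. The time
   bound holds for every outcome of the coin flips, with C and k independent of all arguments. *)
definition apcg_guarantee ::
  "(erm \<Rightarrow> real \<Rightarrow> real \<Rightarrow> real vec \<Rightarrow> real vec \<Rightarrow> real vec timed) \<Rightarrow> bool" where
  "apcg_guarantee APCG \<longleftrightarrow>
     (\<forall>P c lam. erm_problem P \<and> 1 < c \<and> 0 < lam \<longrightarrow> dual_oracle P c lam (APCG P c lam)) \<and>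
     (\<exists>C k. \<forall>P c lam. erm_problem P \<and> 1 < c \<and> 0 < lam \<longrightarrow>
        (\<forall>s\<in>carrier_vec (d_of P). \<forall>y\<in>carrier_vec (n_of P). \<forall>(y', t)\<in>set_pmf (APCG P c lam s y).
           real t \<le> C * polylog_base P lam ^ k *
             (real (n_of P) * real (d_of P) * sqrt (of_int (kappa_reg P lam)) * log1 c)))"

end

theory Submission
  imports Defs
begin

text \<open>
  Let \<open>E\<close> be the primal error at the current centre \<open>x\<close> and \<open>G\<close> the dual gap at \<open>x\<close> of the
  current dual point. The duality gap bounds the squared distance from the dual-to-primal image
  \<open>x'\<close> of a dual point to the proximal point of \<open>x\<close>. For \<open>\<lambda> = \<mu>\<close> an exact proximal step halves
  \<open>E\<close>, so an oracle call that leaves gap \<open>G'\<close> gives \<open>E(x') \<le> E(x) / 2 + (1 + n\<kappa>) G'\<close>, and moving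
  the centre to \<open>x'\<close> turns the gap \<open>G'\<close> into at most \<open>6 G' + 3 E(x)\<close>. Since the oracle shrinks the
  gap in expectation by \<open>\<sigma> \<ge> 80 n\<kappa>\<close>, the potential \<open>E + G / 16\<close> contracts in expectation by \<open>3/4\<close>
  per iteration. It starts at most at \<open>(1 + n\<kappa>) E\<close> by smoothness, so \<open>O(log (n\<kappa>) + log (E / \<epsilon>))\<close>
  iterations suffice.
\<close>

section \<open>Coordinate sums, Cauchy-Schwarz and existence of minimizers\<close>

lemma scalar_prod_sum: "v \<in> carrier_vec d \<Longrightarrow> u \<bullet> v = (\<Sum>j<d. u $ j * v $ j)"
  by (auto simp: scalar_prod_def atLeast0LessThan)

lemma scalar_prod_self_nonneg: "0 \<le> (v :: real vec) \<bullet> v"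
  by (auto simp: scalar_prod_def intro!: sum_nonneg)

lemma vnorm_power2: "(vnorm v)\<^sup>2 = v \<bullet> v"
  by (simp add: vnorm_def scalar_prod_self_nonneg)

lemma scalar_prod_Cauchy_Schwarz:
  fixes u v :: "real vec"
  assumes "u \<in> carrier_vec d" "v \<in> carrier_vec d"
  shows "(u \<bullet> v)\<^sup>2 \<le> (u \<bullet> u) * (v \<bullet> v)"
  using Cauchy_Schwarz_ineq_sum[of "\<lambda>j. u $ j" "\<lambda>j. v $ j" "{..<d}"] assms
  by (simp add: scalar_prod_sum[of _ d] power2_eq_square)

text \<open>A minimizing sequence is Cauchy in every coordinate, which avoids a topology on vectors
  whose dimension is a value.\<close>

lemma strongly_convex_minimizer:
  fixes f :: "real vec \<Rightarrow> real"
  assumes bdd: "\<And>x. x \<in> carrier_vec d \<Longrightarrow> b \<le> f x"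
    and mid: "\<And>x y. x \<in> carrier_vec d \<Longrightarrow> y \<in> carrier_vec d \<Longrightarrow>
      f ((1/2) \<cdot>\<^sub>v x + (1/2) \<cdot>\<^sub>v y) \<le> (f x + f y) / 2 - c * ((x - y) \<bullet> (x - y))"
    and c: "0 < c"
    and cont: "\<And>X x. (\<And>k. X k \<in> carrier_vec d) \<Longrightarrow> x \<in> carrier_vec d \<Longrightarrow>
      (\<And>j. j < d \<Longrightarrow> (\<lambda>k :: nat. X k $ j) \<longlonglongrightarrow> x $ j) \<Longrightarrow> (\<lambda>k. f (X k)) \<longlonglongrightarrow> f x"
  obtains p where "p \<in> carrier_vec d" "\<And>x. x \<in> carrier_vec d \<Longrightarrow> f p \<le> f x"
proof -
  define m where "m = (INF x\<in>carrier_vec d. f x)"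
  have bb: "bdd_below (f ` carrier_vec d)"
    using bdd by (auto simp: bdd_below_def)
  have m_le: "m \<le> f x" if "x \<in> carrier_vec d" for x
    unfolding m_def by (rule cINF_lower[OF bb that])
  have "\<exists>x\<in>carrier_vec d. f x < m + 1 / Suc k" for k
  proof (rule ccontr)
    assume "\<not> ?thesis"
    then have "m + 1 / Suc k \<le> m"
      unfolding m_def by (intro cINF_greatest) (auto simp: not_less intro: zero_carrier_vec)
    then show False by (simp add: field_simps)
  qed
  then obtain X where X: "\<And>k. X k \<in> carrier_vec d" "\<And>k. f (X k) < m + 1 / Suc k"
    by metis
  \<comment> \<open>The midpoint of \<open>X k\<close> and \<open>X l\<close> still has value at
    least \<open>m\<close>, so \<open>mid\<close> bounds \<open>c\<close> times their squared
    distance by the mean excess over \<open>m\<close>. The thresholds on \<open>k\<close> and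
    \<open>l\<close> make each excess smaller than \<open>c * e\<^sup>2\<close>.\<close>
  have close: "\<bar>X k $ j - X l $ j\<bar> < e"
    if j: "j < d" and e: "0 < e" and k: "1 / (c * e\<^sup>2) < real k" and l: "1 / (c * e\<^sup>2) < real l" for j k l e
  proof -
    have small: "1 / Suc i < c * e\<^sup>2" if "1 / (c * e\<^sup>2) < real i" for i
    proof -
      have "1 < c * e\<^sup>2 * real i"
        using that c e by (simp add: field_simps)
      also have "\<dots> \<le> c * e\<^sup>2 * real (Suc i)"
        using c by (intro mult_left_mono) auto
      finally show ?thesis by (simp add: field_simps)
    qed
    have "(X k $ j - X l $ j)\<^sup>2 \<le> (\<Sum>i<d. (X k $ i - X l $ i)\<^sup>2)"
      using j by (intro member_le_sum) auto
    also have "\<dots> = (X k - X l) \<bullet> (X k - X l)"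
      using X(1)[of k] X(1)[of l] by (simp add: scalar_prod_sum[of _ d] power2_eq_square)
    finally have "c * (X k $ j - X l $ j)\<^sup>2 \<le> c * ((X k - X l) \<bullet> (X k - X l))"
      using c by simp
    also have "\<dots> \<le> (f (X k) + f (X l)) / 2 - m"
      using mid[OF X(1) X(1), of k l] m_le[of "(1/2) \<cdot>\<^sub>v X k + (1/2) \<cdot>\<^sub>v X l"] X(1) by auto
    also have "\<dots> < c * e\<^sup>2"
      using X(2)[of k] X(2)[of l] small[OF k] small[OF l] by argo
    finally have "(X k $ j - X l $ j)\<^sup>2 < e\<^sup>2"
      using c by simp
    then show ?thesis
      using e by (metis abs_of_pos power2_less_imp_less power2_abs abs_ge_zero less_imp_le)
  qed
  have "convergent (\<lambda>k. X k $ j)" if "j < d" for j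
  proof (rule Cauchy_convergent, rule metric_CauchyI)
    fix e :: real assume "0 < e"
    obtain N where "1 / (c * e\<^sup>2) < real N"
      using reals_Archimedean2 by blast
    then show "\<exists>M. \<forall>k\<ge>M. \<forall>l\<ge>M. dist (X k $ j) (X l $ j) < e"
      using close[OF that \<open>0 < e\<close>] by (intro exI[of _ N]) (auto simp: dist_real_def)
  qed
  then obtain \<xi> where \<xi>: "\<And>j. j < d \<Longrightarrow> (\<lambda>k. X k $ j) \<longlonglongrightarrow> \<xi> j"
    unfolding convergent_def by metis
  have lim: "(\<lambda>k. f (X k)) \<longlonglongrightarrow> f (Matrix.vec d \<xi>)"
    using X \<xi> by (intro cont) auto
  have "(\<lambda>k. m + 1 / Suc k) \<longlonglongrightarrow> m + 0"
    by (intro tendsto_add tendsto_const LIMSEQ_Suc[OF lim_1_over_n])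
  then have "f (Matrix.vec d \<xi>) \<le> m + 0"
    using X(2) by (intro LIMSEQ_le[OF lim]) (auto intro: less_imp_le)
  then show thesis
    using m_le by (intro that[of "Matrix.vec d \<xi>"]) (auto intro: order_trans)
qed

section \<open>Fenchel conjugates of smooth convex losses\<close>

lemma fenchel_conjugate_ge: "ereal (x * y - \<phi> x) \<le> fenchel_conjugate \<phi> y"
  unfolding fenchel_conjugate_def by (rule SUP_upper) simp

lemma convex_tangent_le:
  assumes "convex_on UNIV \<phi>" "L_smooth L \<phi>"
  shows "\<phi> w + deriv \<phi> w * (z - w) \<le> \<phi> z"
proof -
  have "(\<phi> has_field_derivative deriv \<phi> w) (at w)"
    using assms(2) by (auto simp: L_smooth_def DERIV_deriv_iff_real_differentiable)
  from convex_on_imp_above_tangent[OF assms(1) _ _ _ this, of z] show ?thesis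
    by simp
qed

text \<open>By the tangent inequality the supremum is attained at \<open>w\<close>: the equality
  case of Fenchel-Young. It makes the conjugates finite and explicit at the dual points produced by
  \<open>primal_to_dual\<close>.\<close>

lemma fenchel_conjugate_deriv:
  assumes "convex_on UNIV \<phi>" "L_smooth L \<phi>"
  shows "fenchel_conjugate \<phi> (deriv \<phi> w) = ereal (w * deriv \<phi> w - \<phi> w)"
proof (rule antisym)
  show "fenchel_conjugate \<phi> (deriv \<phi> w) \<le> ereal (w * deriv \<phi> w - \<phi> w)"
    unfolding fenchel_conjugate_def
    using convex_tangent_le[OF assms, of w] by (intro SUP_least) (auto simp: algebra_simps)
qed (rule fenchel_conjugate_ge)

section \<open>Gradient and smoothness of F\<close>

locale erm_analysis =
  fixes P :: erm
  assumes erm: "erm_problem P"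
begin

abbreviation "n \<equiv> n_of P"
abbreviation "d \<equiv> d_of P"
abbreviation "\<mu> \<equiv> strong_convexity P"
abbreviation "F \<equiv> objective P"
abbreviation "a \<equiv> row (data P)"

text \<open>A smoothness constant of F: each of the n rows contributes curvature at most L *
  R^2.\<close>

definition \<beta> :: real where
  "\<beta> = real n * smoothness P * (radius P)\<^sup>2"

text \<open>The gradient of F by the chain rule. Instead of differentiability on vectors, the bounds
  \<open>objective_upper\<close> and \<open>objective_lower\<close> express what it means.\<close>

definition grad :: "real vec \<Rightarrow> real vec" where
  "grad x = (data P)\<^sup>T *\<^sub>v primal_to_dual P x"

definition excess :: "real vec \<Rightarrow> real" where
  "excess x = F x - min_objective P"

lemma n_pos: "0 < n" and d_pos: "0 < d" and L_pos: "0 < smoothness P" and mu_pos: "0 < \<mu>"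
  using erm by (auto simp: erm_problem_def)

lemma loss_convex: "i < n \<Longrightarrow> convex_on UNIV (loss P i)"
  and loss_smooth: "i < n \<Longrightarrow> L_smooth (smoothness P) (loss P i)"
  using erm by (auto simp: erm_problem_def)

lemma a_carrier [simp]: "i < n \<Longrightarrow> a i \<in> carrier_vec d"
  by (auto simp: row_def)

lemma transpose_carrier [simp]: "(data P)\<^sup>T *\<^sub>v y \<in> carrier_vec d"
  by (metis carrier_matI index_transpose_mat(2) mult_mat_vec_carrier dim_mult_mat_vec carrier_vecI)

lemma primal_to_dual_carrier [simp]: "primal_to_dual P x \<in> carrier_vec n"
  by (simp add: primal_to_dual_def)

lemma grad_carrier [simp]: "grad x \<in> carrier_vec d"
  by (simp add: grad_def)

lemma dual_to_primal_carrier [simp]: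
  "s \<in> carrier_vec d \<Longrightarrow> dual_to_primal P s lam y \<in> carrier_vec d"
  unfolding dual_to_primal_def by auto

lemma transpose_scalar_prod:
  assumes "y \<in> carrier_vec n" "h \<in> carrier_vec d"
  shows "((data P)\<^sup>T *\<^sub>v y) \<bullet> h = (\<Sum>i<n. y $ i * (a i \<bullet> h))"
proof -
  have "((data P)\<^sup>T *\<^sub>v y) \<bullet> h = (\<Sum>j<d. \<Sum>i<n. data P $$ (i, j) * y $ i * h $ j)"
    using assms by (simp add: scalar_prod_sum[of _ d] scalar_prod_sum[of _ n] sum_distrib_right)
  also have "\<dots> = (\<Sum>i<n. \<Sum>j<d. data P $$ (i, j) * y $ i * h $ j)"
    by (rule sum.swap)
  also have "\<dots> = (\<Sum>i<n. y $ i * (a i \<bullet> h))"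
    using assms by (simp add: scalar_prod_sum[of _ d] sum_distrib_left mult_ac)
  finally show ?thesis .
qed

lemma grad_scalar_prod:
  "h \<in> carrier_vec d \<Longrightarrow> grad x \<bullet> h = (\<Sum>i<n. deriv (loss P i) (a i \<bullet> x) * (a i \<bullet> h))"
  unfolding grad_def by (simp add: transpose_scalar_prod) (simp add: primal_to_dual_def)

lemma a_scalar_prod_sq_le:
  assumes "i < n" "h \<in> carrier_vec d"
  shows "(a i \<bullet> h)\<^sup>2 \<le> (radius P)\<^sup>2 * (h \<bullet> h)"
proof -
  have "vnorm (a i) \<le> radius P"
    unfolding radius_def using assms(1) by (intro Max_ge) auto
  then have "a i \<bullet> a i \<le> (radius P)\<^sup>2"
    unfolding vnorm_power2[symmetric]
    by (intro power_mono) (auto simp: vnorm_def scalar_prod_self_nonneg)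
  then have "(a i \<bullet> a i) * (h \<bullet> h) \<le> (radius P)\<^sup>2 * (h \<bullet> h)"
    by (intro mult_right_mono scalar_prod_self_nonneg)
  then show ?thesis
    using scalar_prod_Cauchy_Schwarz[of "a i" d h] assms by simp
qed

text \<open>Sums the smoothness inequalities of the losses at \<open>a i \<bullet> x\<close>;
  Cauchy-Schwarz replaces each (a_i . h)^2 by R^2 |h|^2.\<close>

lemma objective_upper:
  assumes x: "x \<in> carrier_vec d" and h: "h \<in> carrier_vec d"
  shows "F (x + h) \<le> F x + grad x \<bullet> h + \<beta> / 2 * (h \<bullet> h)"
proof -
  let ?L = "smoothness P"
  have "F (x + h) \<le> (\<Sum>i<n. loss P i (a i \<bullet> x) + deriv (loss P i) (a i \<bullet> x) * (a i \<bullet> h)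
      + ?L / 2 * ((radius P)\<^sup>2 * (h \<bullet> h)))"
    unfolding objective_def
  proof (intro sum_mono)
    fix i assume "i \<in> {..<n}"
    then have i: "i < n" by simp
    have eq: "a i \<bullet> (x + h) = a i \<bullet> x + a i \<bullet> h"
      using i x h by (intro scalar_prod_add_distrib[of _ d]) auto
    have "loss P i (a i \<bullet> (x + h)) \<le> loss P i (a i \<bullet> x) + deriv (loss P i) (a i \<bullet> x) * (a i \<bullet> h)
        + ?L / 2 * (a i \<bullet> h)\<^sup>2"
      using loss_smooth[OF i] unfolding L_smooth_def eq by (auto dest: spec[of _ "a i \<bullet> x + a i \<bullet> h"])
         (metis add_diff_cancel_left')
    also have "\<dots> \<le> loss P i (a i \<bullet> x) + deriv (loss P i) (a i \<bullet> x) * (a i \<bullet> h)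
        + ?L / 2 * ((radius P)\<^sup>2 * (h \<bullet> h))"
      using a_scalar_prod_sq_le[OF i h] L_pos by (intro add_left_mono mult_left_mono) auto
    finally show "loss P i (a i \<bullet> (x + h)) \<le> loss P i (a i \<bullet> x) + deriv (loss P i) (a i \<bullet> x) * (a i \<bullet> h)
        + ?L / 2 * ((radius P)\<^sup>2 * (h \<bullet> h))" .
  qed
  also have "\<dots> = F x + grad x \<bullet> h + \<beta> / 2 * (h \<bullet> h)"
    by (simp add: sum.distrib objective_def grad_scalar_prod[OF h] \<beta>_def)
  finally show ?thesis .
qed

lemma objective_lower:
  assumes x: "x \<in> carrier_vec d" and h: "h \<in> carrier_vec d"
  shows "F x + grad x \<bullet> h \<le> F (x + h)"
proof -
  have "F x + grad x \<bullet> h = (\<Sum>i<n. loss P i (a i \<bullet> x) + deriv (loss P i) (a i \<bullet> x) * (a i \<bullet> h))"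
    by (simp add: sum.distrib objective_def grad_scalar_prod[OF h])
  also have "\<dots> \<le> F (x + h)"
    unfolding objective_def
  proof (intro sum_mono)
    fix i assume "i \<in> {..<n}"
    then have i: "i < n" by simp
    have eq: "a i \<bullet> (x + h) = a i \<bullet> x + a i \<bullet> h"
      using i x h by (intro scalar_prod_add_distrib[of _ d]) auto
    show "loss P i (a i \<bullet> x) + deriv (loss P i) (a i \<bullet> x) * (a i \<bullet> h) \<le> loss P i (a i \<bullet> (x + h))"
      using convex_tangent_le[OF loss_convex[OF i] loss_smooth[OF i], of "a i \<bullet> x" "a i \<bullet> x + a i \<bullet> h"]
      by (simp add: eq)
  qed
  finally show ?thesis .
qed

section \<open>Strong convexity at midpoints and the minimum of F\<close>

lemma objective_midpoint:
  assumes "x \<in> carrier_vec d" "y \<in> carrier_vec d"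
  shows "F ((1/2) \<cdot>\<^sub>v x + (1/2) \<cdot>\<^sub>v y) \<le> (F x + F y) / 2 - \<mu> / 8 * ((x - y) \<bullet> (x - y))"
proof -
  have "strongly_convex \<mu> d F"
    using erm by (simp add: erm_problem_def)
  moreover have half: "1/2 \<in> {0..1 :: real}"
    by simp
  ultimately have "F ((1 - 1/2) \<cdot>\<^sub>v x + (1/2) \<cdot>\<^sub>v y)
      \<le> (1 - 1/2) * F x + (1/2) * F y - \<mu> / 2 * (1/2) * (1 - 1/2) * (vnorm (x - y))\<^sup>2"
    using assms half unfolding strongly_convex_def by blast
  then show ?thesis
    by (simp add: vnorm_power2 add_divide_distrib)
qed

lemma quadratic_bounded_below:
  fixes v h :: "real vec"
  assumes "0 < c" "v \<in> carrier_vec d'" "h \<in> carrier_vec d'"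
  shows "- (v \<bullet> v) / (4 * c) \<le> v \<bullet> h + c * (h \<bullet> h)"
proof -
  have "v \<bullet> h + c * (h \<bullet> h) + (v \<bullet> v) / (4 * c) = (\<Sum>j<d'. (v $ j + 2 * c * h $ j)\<^sup>2 / (4 * c))"
    using assms
    by (simp add: scalar_prod_sum[of _ d'] sum_distrib_left sum_divide_distrib flip: sum.distrib)
      (auto intro!: sum.cong simp: field_simps power2_eq_square)
  also have "\<dots> \<ge> 0"
    using assms by (intro sum_nonneg) auto
  finally show ?thesis by linarith
qed

text \<open>Sandwich F(y/2) between the tangent at 0 and the midpoint inequality for 0 and y. This
  gives F(y) \<ge> F(0) + grad 0 . y + (\<mu>/4) |y|^2, and completing the square removes y. Hence
  \<open>min_objective\<close> is a genuine infimum.\<close>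

lemma objective_bdd_below: "bdd_below (F ` carrier_vec d)"
proof -
  let ?z = "0\<^sub>v d :: real vec"
  have "F ?z - (grad ?z \<bullet> grad ?z) / \<mu> \<le> F y" if y: "y \<in> carrier_vec d" for y
  proof -
    have "- (grad ?z \<bullet> grad ?z) / (4 * (\<mu> / 4)) \<le> grad ?z \<bullet> y + \<mu> / 4 * (y \<bullet> y)"
      using mu_pos y by (intro quadratic_bounded_below) auto
    moreover have "F ?z + grad ?z \<bullet> ((1/2) \<cdot>\<^sub>v y) \<le> F (?z + (1/2) \<cdot>\<^sub>v y)"
      using y by (intro objective_lower) auto
    moreover have "F ((1/2) \<cdot>\<^sub>v ?z + (1/2) \<cdot>\<^sub>v y) \<le> (F ?z + F y) / 2 - \<mu> / 8 * ((?z - y) \<bullet> (?z - y))"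
      using y by (intro objective_midpoint) auto
    moreover have "(?z - y) \<bullet> (?z - y) = y \<bullet> y" "(1/2) \<cdot>\<^sub>v ?z = ?z"
      "grad ?z \<bullet> ((1/2) \<cdot>\<^sub>v y) = (grad ?z \<bullet> y) / 2"
      using y by (auto simp: scalar_prod_sum[of _ d] sum_divide_distrib)
    moreover have "4 * (\<mu> / 4) = \<mu>"
      by simp
    ultimately show ?thesis
      by (simp only: minus_divide_left[symmetric]) argo
  qed
  then show ?thesis
    by (auto simp: bdd_below_def)
qed

lemma excess_nonneg: "x \<in> carrier_vec d \<Longrightarrow> 0 \<le> excess x"
  unfolding excess_def min_objective_def using cINF_lower[OF objective_bdd_below] by simp

text \<open>A gradient step of length 1/\<beta> lowers F by |grad x|^2 / (2 \<beta>), but never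
  below the minimum.\<close>

lemma grad_sq_le:
  assumes x: "x \<in> carrier_vec d" and "0 < \<beta>"
  shows "grad x \<bullet> grad x \<le> 2 * \<beta> * excess x"
proof -
  let ?h = "(- 1 / \<beta>) \<cdot>\<^sub>v grad x"
  have "F (x + ?h) \<le> F x + grad x \<bullet> ?h + \<beta> / 2 * (?h \<bullet> ?h)"
    using x by (intro objective_upper) auto
  also have "\<dots> = F x - (grad x \<bullet> grad x) / (2 * \<beta>)"
    using assms by (simp add: field_simps)
  finally have "(grad x \<bullet> grad x) / (2 * \<beta>) \<le> excess x"
    using excess_nonneg[of "x + ?h"] assms by (simp add: excess_def)
  then show ?thesis
    using assms by (simp add: field_simps)
qed

lemma objective_tendsto:
  assumes X: "\<And>k. X k \<in> carrier_vec d" and x: "x \<in> carrier_vec d"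
    and lim: "\<And>j. j < d \<Longrightarrow> (\<lambda>k :: nat. X k $ j) \<longlonglongrightarrow> x $ j"
  shows "(\<lambda>k. F (X k)) \<longlonglongrightarrow> F x"
  unfolding objective_def
proof (intro tendsto_sum)
  fix i assume "i \<in> {..<n}"
  then have i: "i < n" by simp
  have "isCont (loss P i) (a i \<bullet> x)"
    using loss_smooth[OF i] unfolding L_smooth_def
    by (meson differentiable_imp_continuous_within)
  moreover have "(\<lambda>k. a i \<bullet> X k) \<longlonglongrightarrow> a i \<bullet> x"
    unfolding scalar_prod_sum[OF X] scalar_prod_sum[OF x]
    using lim by (intro tendsto_sum tendsto_mult tendsto_const) auto
  ultimately show "(\<lambda>k. loss P i (a i \<bullet> X k)) \<longlonglongrightarrow> loss P i (a i \<bullet> x)"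
    by (rule isCont_tendsto_compose)
qed

text \<open>Compares strong convexity with smoothness on the segment from \<open>-e\<^sub>0\<close> to \<open>e\<^sub>0\<close>.\<close>

lemma \<beta>_ge_mu: "\<mu> \<le> \<beta>"
proof -
  let ?h = "unit_vec d 0 :: real vec" and ?z = "0\<^sub>v d :: real vec"
  have "F ((1/2) \<cdot>\<^sub>v (?z + ?h) + (1/2) \<cdot>\<^sub>v (?z + (-1) \<cdot>\<^sub>v ?h)) \<le> (F (?z + ?h) + F (?z + (-1) \<cdot>\<^sub>v ?h)) / 2
     - \<mu> / 8 * ((?z + ?h - (?z + (-1) \<cdot>\<^sub>v ?h)) \<bullet> (?z + ?h - (?z + (-1) \<cdot>\<^sub>v ?h)))"
    by (intro objective_midpoint) auto
  moreover have "(1/2) \<cdot>\<^sub>v (?z + ?h) + (1/2) \<cdot>\<^sub>v (?z + (-1) \<cdot>\<^sub>v ?h) = ?z"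
    by (intro eq_vecI) auto
  moreover have "?z + ?h - (?z + (-1) \<cdot>\<^sub>v ?h) = 2 \<cdot>\<^sub>v ?h"
    by (intro eq_vecI) auto
  moreover have "F (?z + ?h) \<le> F ?z + grad ?z \<bullet> ?h + \<beta> / 2 * (?h \<bullet> ?h)"
    by (intro objective_upper) auto
  moreover have "F (?z + (-1) \<cdot>\<^sub>v ?h) \<le> F ?z + grad ?z \<bullet> ((-1) \<cdot>\<^sub>v ?h) + \<beta> / 2 * (((-1) \<cdot>\<^sub>v ?h) \<bullet> ((-1) \<cdot>\<^sub>v ?h))"
    by (intro objective_upper) auto
  moreover have "?h \<bullet> ?h = 1"
    using d_pos by simp
  ultimately show ?thesis
    by simp argo
qed

lemma \<beta>_pos: "0 < \<beta>"
  using \<beta>_ge_mu mu_pos by simp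

lemma radius_pos: "0 < radius P"
proof -
  have "0 \<le> vnorm (a 0)"
    by (simp add: vnorm_def scalar_prod_self_nonneg)
  also have "\<dots> \<le> radius P"
    unfolding radius_def using n_pos by (intro Max_ge) auto
  finally show ?thesis
    using \<beta>_pos by (cases "radius P = 0") (auto simp: \<beta>_def)
qed

section \<open>Proximal points and the Moreau envelope\<close>

definition reg :: "real \<Rightarrow> real vec \<Rightarrow> real vec \<Rightarrow> real" where
  "reg lam s x = F x + lam / 2 * ((x - s) \<bullet> (x - s))"

definition prox :: "real \<Rightarrow> real vec \<Rightarrow> real vec" where
  "prox lam s = (SOME p. p \<in> carrier_vec d \<and> (\<forall>x\<in>carrier_vec d. reg lam s p \<le> reg lam s x))"

definition moreau :: "real \<Rightarrow> real vec \<Rightarrow> real" where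
  "moreau lam s = reg lam s (prox lam s)"

text \<open>\<open>strongly_convex_minimizer\<close> applies with the constant
  \<open>\<mu> / 8\<close> inherited from F; the proximal term contributes midpoint convexity and
  continuity. Existence justifies the choice made in \<open>prox\<close>.\<close>

lemma
  assumes s: "s \<in> carrier_vec d" and lam: "0 < lam"
  shows prox_carrier: "prox lam s \<in> carrier_vec d"
    and prox_min: "\<And>x. x \<in> carrier_vec d \<Longrightarrow> moreau lam s \<le> reg lam s x"
proof -
  have "\<exists>p. p \<in> carrier_vec d \<and> (\<forall>x\<in>carrier_vec d. reg lam s p \<le> reg lam s x)"
  proof (rule strongly_convex_minimizer[of d "min_objective P" "reg lam s" "\<mu> / 8"])
    fix x :: "real vec" assume x: "x \<in> carrier_vec d"
    show "min_objective P \<le> reg lam s x"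
      using excess_nonneg[OF x] lam scalar_prod_self_nonneg[of "x - s"]
      by (auto simp: reg_def excess_def intro!: add_increasing2)
  next
    fix x y :: "real vec" assume x: "x \<in> carrier_vec d" and y: "y \<in> carrier_vec d"
    let ?m = "(1/2) \<cdot>\<^sub>v x + (1/2) \<cdot>\<^sub>v y"
    have "(?m - s) \<bullet> (?m - s) \<le> (\<Sum>j<d. ((x $ j - s $ j)\<^sup>2 + (y $ j - s $ j)\<^sup>2) / 2)"
      using x y s
    proof (simp add: scalar_prod_sum[of _ d], intro sum_mono)
      fix j
      have "((x $ j - s $ j)\<^sup>2 + (y $ j - s $ j)\<^sup>2) / 2 - (x $ j / 2 + y $ j / 2 - s $ j) * (x $ j / 2 + y $ j / 2 - s $ j)
          = ((x $ j - y $ j) / 2)\<^sup>2"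
        by (simp add: power2_eq_square field_simps)
      also have "\<dots> \<ge> 0" by simp
      finally show "(x $ j / 2 + y $ j / 2 - s $ j) * (x $ j / 2 + y $ j / 2 - s $ j)
          \<le> ((x $ j - s $ j)\<^sup>2 + (y $ j - s $ j)\<^sup>2) / 2" by simp
    qed
    also have "\<dots> = ((x - s) \<bullet> (x - s) + (y - s) \<bullet> (y - s)) / 2"
      using x y s
      by (simp add: scalar_prod_sum[of _ d] sum.distrib sum_divide_distrib power2_eq_square add_divide_distrib)
    finally have "lam / 2 * ((?m - s) \<bullet> (?m - s)) \<le> lam / 2 * (((x - s) \<bullet> (x - s) + (y - s) \<bullet> (y - s)) / 2)"
      using lam by (intro mult_left_mono) auto
    with objective_midpoint[OF x y]
    show "reg lam s ?m \<le> (reg lam s x + reg lam s y) / 2 - \<mu> / 8 * ((x - y) \<bullet> (x - y))"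
      unfolding reg_def by argo
  next
    fix X and x :: "real vec" assume X: "\<And>k :: nat. X k \<in> carrier_vec d" and x: "x \<in> carrier_vec d"
      and lim: "\<And>j. j < d \<Longrightarrow> (\<lambda>k. X k $ j) \<longlonglongrightarrow> x $ j"
    have "(\<lambda>k. \<Sum>j<d. (X k $ j - s $ j) * (X k $ j - s $ j)) \<longlonglongrightarrow> (\<Sum>j<d. (x $ j - s $ j) * (x $ j - s $ j))"
      using lim by (intro tendsto_sum tendsto_mult tendsto_diff tendsto_const) auto
    then have "(\<lambda>k. (X k - s) \<bullet> (X k - s)) \<longlonglongrightarrow> (x - s) \<bullet> (x - s)"
      using X x s carrier_vecD[OF X] by (simp add: scalar_prod_sum[of _ d])
    then show "(\<lambda>k. reg lam s (X k)) \<longlonglongrightarrow> reg lam s x"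
      unfolding reg_def by (intro tendsto_add objective_tendsto[OF X x lim] tendsto_mult tendsto_const)
  qed (use mu_pos in auto)
  from someI_ex[OF this] show "prox lam s \<in> carrier_vec d"
    "\<And>x. x \<in> carrier_vec d \<Longrightarrow> moreau lam s \<le> reg lam s x"
    unfolding prox_def moreau_def by auto
qed

text \<open>First-order optimality, obtained without differentiating \<open>reg\<close>. If g
  denotes the gradient of \<open>reg\<close> at p, the trial step -g/b with b = \<beta> + lam
  changes \<open>reg\<close> by at most -|g|^2 / (2 b); minimality of p forces g = 0.\<close>

lemma prox_grad:
  assumes s: "s \<in> carrier_vec d" and lam: "0 < lam"
  shows "grad (prox lam s) = lam \<cdot>\<^sub>v (s - prox lam s)"
proof -
  define p where "p = prox lam s"
  have p: "p \<in> carrier_vec d"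
    using prox_carrier[OF s lam] by (simp add: p_def)
  define g where "g = grad p + lam \<cdot>\<^sub>v (p - s)"
  have g: "g \<in> carrier_vec d"
    unfolding g_def using p s by auto
  define b where "b = \<beta> + lam"
  have b: "0 < b"
    using \<beta>_pos lam by (simp add: b_def)
  define h where "h = (- 1 / b) \<cdot>\<^sub>v g"
  have h: "h \<in> carrier_vec d"
    using g by (simp add: h_def)
  have "reg lam s p \<le> reg lam s (p + h)"
    using prox_min[OF s lam, of "p + h"] p h unfolding moreau_def p_def by auto
  also have "\<dots> \<le> F p + grad p \<bullet> h + \<beta> / 2 * (h \<bullet> h) + lam / 2 * ((p + h - s) \<bullet> (p + h - s))"
    unfolding reg_def using objective_upper[OF p h] by simp
  also have "(p + h - s) \<bullet> (p + h - s) = (p - s) \<bullet> (p - s) + 2 * ((p - s) \<bullet> h) + h \<bullet> h"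
    using p h s by (simp add: scalar_prod_sum[of _ d] sum_distrib_left flip: sum.distrib)
      (auto intro!: sum.cong simp: algebra_simps)
  also have "F p + grad p \<bullet> h + \<beta> / 2 * (h \<bullet> h) + lam / 2 * ((p - s) \<bullet> (p - s) + 2 * ((p - s) \<bullet> h) + h \<bullet> h)
      = reg lam s p + (grad p \<bullet> h + lam * ((p - s) \<bullet> h)) + b / 2 * (h \<bullet> h)"
    by (simp add: reg_def b_def field_simps)
  also have "grad p \<bullet> h + lam * ((p - s) \<bullet> h) = g \<bullet> h"
    unfolding g_def using p h s grad_carrier[of p] carrier_vecD[OF grad_carrier[of p]]
    by (simp add: scalar_prod_sum[of _ d] sum_distrib_left flip: sum.distrib)
      (auto intro!: sum.cong simp: algebra_simps)
  finally have "0 \<le> g \<bullet> h + b / 2 * (h \<bullet> h)"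
    by simp
  also have "\<dots> = - (g \<bullet> g) / (2 * b)"
    using g b by (simp add: h_def field_simps)
  finally have "g \<bullet> g \<le> 0"
    using b by (simp add: field_simps)
  then have "(\<Sum>j<d. g $ j * g $ j) = 0"
    using scalar_prod_self_nonneg[of g] g by (simp add: scalar_prod_sum[of _ d])
  then have "g $ j = 0" if "j < d" for j
    using that by (subst (asm) sum_nonneg_eq_0_iff) auto
  then have "grad p $ j + lam * (p $ j - s $ j) = 0" if "j < d" for j
    using that p s carrier_vecD[OF grad_carrier[of p]] unfolding g_def by fastforce
  then have "grad p = lam \<cdot>\<^sub>v (s - p)"
    using p s carrier_vecD[OF grad_carrier[of p]]
    by (intro eq_vecI) (auto simp: algebra_simps)
  then show ?thesis
    by (simp add: p_def)
qed

text \<open>Compare the envelope with the trial point \<open>s\<close>, where the proximal term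
  vanishes, and use that F at the proximal point is at least the minimum.\<close>

lemma prox_dist_le:
  assumes s: "s \<in> carrier_vec d" and lam: "0 < lam"
  shows "lam / 2 * ((prox lam s - s) \<bullet> (prox lam s - s)) \<le> excess s"
proof -
  have "moreau lam s \<le> F s"
    using prox_min[OF s lam s] s by (simp add: reg_def)
  then show ?thesis
    using excess_nonneg[OF prox_carrier[OF s lam]] by (simp add: moreau_def reg_def excess_def)
qed

text \<open>Test the envelope at the midpoint of \<open>s\<close> and an arbitrary z. Its proximal
  term is (\<mu>/8) |s - z|^2, exactly what the midpoint inequality gains; this is where lam = \<mu>
  enters.\<close>

lemma moreau_contraction:
  assumes s: "s \<in> carrier_vec d"
  shows "moreau \<mu> s - min_objective P \<le> excess s / 2"
proof -
  \<comment> \<open>Rearranged so that z occurs on the right only, which lets the bound pass to the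
    infimum over z.\<close>
  have "2 * moreau \<mu> s - F s \<le> min_objective P"
    unfolding min_objective_def
  proof (intro cINF_greatest)
    fix z :: "real vec" assume z: "z \<in> carrier_vec d"
    let ?m = "(1/2) \<cdot>\<^sub>v s + (1/2) \<cdot>\<^sub>v z"
    have eq: "(?m - s) \<bullet> (?m - s) = 1 / 4 * ((s - z) \<bullet> (s - z))"
      using s z by (simp add: scalar_prod_sum[of _ d] sum_distrib_left)
        (auto intro!: sum.cong simp: field_simps)
    have "moreau \<mu> s \<le> reg \<mu> s ?m"
      using s z by (intro prox_min mu_pos) auto
    with objective_midpoint[OF s z] show "2 * moreau \<mu> s - F s \<le> F z"
      unfolding reg_def eq by argo
  qed (auto intro: zero_carrier_vec)
  then show ?thesis
    by (simp add: excess_def)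
qed

section \<open>The dual objective and strong duality\<close>

definition conj_sum :: "real vec \<Rightarrow> ereal" where
  "conj_sum y = (\<Sum>i<n. fenchel_conjugate (loss P i) (y $ i))"

text \<open>The real-valued part of the dual objective and the only one that depends on the centre
  \<open>s\<close>; infinite values come from \<open>conj_sum\<close> alone.\<close>

definition dual_quad :: "real \<Rightarrow> real vec \<Rightarrow> real vec \<Rightarrow> real" where
  "dual_quad lam s y = 1 / (2 * lam) * (((data P)\<^sup>T *\<^sub>v y) \<bullet> ((data P)\<^sup>T *\<^sub>v y)) - s \<bullet> ((data P)\<^sup>T *\<^sub>v y)"

lemma dual_objective_eq: "dual_objective P s lam y = conj_sum y + ereal (dual_quad lam s y)"
  by (simp add: dual_objective_def conj_sum_def dual_quad_def vnorm_power2)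

text \<open>Fenchel-Young for every loss at a_i . x, summed over i.\<close>

lemma conj_sum_ge:
  assumes "y \<in> carrier_vec n" "x \<in> carrier_vec d"
  shows "ereal (((data P)\<^sup>T *\<^sub>v y) \<bullet> x - F x) \<le> conj_sum y"
proof -
  have "ereal (((data P)\<^sup>T *\<^sub>v y) \<bullet> x - F x) = (\<Sum>i<n. ereal ((a i \<bullet> x) * y $ i - loss P i (a i \<bullet> x)))"
    using assms by (simp add: transpose_scalar_prod objective_def sum_subtractf mult.commute)
  also have "\<dots> \<le> conj_sum y"
    unfolding conj_sum_def by (intro sum_mono fenchel_conjugate_ge)
  finally show ?thesis .
qed

lemma conj_sum_primal_to_dual:
  assumes "x \<in> carrier_vec d"
  shows "conj_sum (primal_to_dual P x) = ereal (grad x \<bullet> x - F x)"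
proof -
  have "conj_sum (primal_to_dual P x)
      = (\<Sum>i<n. ereal ((a i \<bullet> x) * deriv (loss P i) (a i \<bullet> x) - loss P i (a i \<bullet> x)))"
    unfolding conj_sum_def
    by (intro sum.cong) (auto simp: primal_to_dual_def fenchel_conjugate_deriv[OF loss_convex loss_smooth])
  also have "\<dots> = ereal (grad x \<bullet> x - F x)"
    using assms by (simp add: grad_scalar_prod objective_def sum_subtractf mult.commute)
  finally show ?thesis .
qed

lemma conj_sum_cases:
  assumes "y \<in> carrier_vec n"
  obtains "conj_sum y = \<infinity>" | c where "conj_sum y = ereal c"
  using conj_sum_ge[OF assms zero_carrier_vec] by (cases "conj_sum y") auto

text \<open>With w = A^T y and p the proximal point, the right side minus the left side is c + F(p)
  - w . p after completing the square, which is nonnegative by Fenchel-Young.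
  \<open>INF_dual_objective\<close> identifies the right side as the dual gap.\<close>

lemma prox_dist_le_gap:
  assumes y: "y \<in> carrier_vec n" and s: "s \<in> carrier_vec d" and lam: "0 < lam"
    and c: "conj_sum y = ereal c"
  defines "\<delta> \<equiv> dual_to_primal P s lam y - prox lam s"
  shows "lam / 2 * (\<delta> \<bullet> \<delta>) \<le> c + dual_quad lam s y + moreau lam s"
proof -
  define w where "w = (data P)\<^sup>T *\<^sub>v y"
  define p where "p = prox lam s"
  have w: "w \<in> carrier_vec d" and p: "p \<in> carrier_vec d"
    using prox_carrier[OF s lam] by (simp_all add: w_def p_def)
  have "lam / 2 * (\<delta> \<bullet> \<delta>) = w \<bullet> p + (1 / (2 * lam) * (w \<bullet> w) - s \<bullet> w) + lam / 2 * ((p - s) \<bullet> (p - s))"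
    unfolding \<delta>_def dual_to_primal_def w_def[symmetric] p_def[symmetric]
    using w p s lam
    by (simp add: scalar_prod_sum[of _ d] sum_distrib_left flip: sum.distrib sum_subtractf)
      (auto intro!: sum.cong simp: field_simps)
  moreover have "w \<bullet> p - F p \<le> c"
    using conj_sum_ge[OF y p] by (simp add: c w_def)
  ultimately show ?thesis
    unfolding dual_quad_def moreau_def reg_def w_def[symmetric] p_def[symmetric] by linarith
qed

text \<open>The value is attained at the dual image of the proximal point p, where the conjugates
  are explicit and \<open>prox_grad\<close> gives A^T y = lam (s - p). The lower bound is
  \<open>prox_dist_le_gap\<close> with its left side dropped as nonnegative.\<close>

lemma INF_dual_objective:
  assumes s: "s \<in> carrier_vec d" and lam: "0 < lam"
  shows "(INF z\<in>carrier_vec n. dual_objective P s lam z) = ereal (- moreau lam s)"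
proof (rule antisym)
  define p where "p = prox lam s"
  have p: "p \<in> carrier_vec d"
    using prox_carrier[OF s lam] by (simp add: p_def)
  have "grad p \<bullet> p - F p + (1 / (2 * lam) * (grad p \<bullet> grad p) - s \<bullet> grad p) = - moreau lam s"
    unfolding moreau_def reg_def p_def[symmetric]
    unfolding prox_grad[OF s lam, folded p_def]
    using p s lam
    by (simp add: scalar_prod_sum[of _ d] sum_distrib_left flip: sum.distrib sum_subtractf sum_negf)
      (auto intro!: sum.cong simp: field_simps)
  then have "dual_objective P s lam (primal_to_dual P p) = ereal (- moreau lam s)"
    by (simp add: dual_objective_eq conj_sum_primal_to_dual[OF p] dual_quad_def grad_def[symmetric])
  then show "(INF z\<in>carrier_vec n. dual_objective P s lam z) \<le> ereal (- moreau lam s)"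
    by (metis INF_lower primal_to_dual_carrier)
  show "ereal (- moreau lam s) \<le> (INF z\<in>carrier_vec n. dual_objective P s lam z)"
  proof (intro INF_greatest)
    fix z :: "real vec" assume z: "z \<in> carrier_vec n"
    then show "ereal (- moreau lam s) \<le> dual_objective P s lam z"
    proof (cases rule: conj_sum_cases)
      case (2 c)
      let ?\<delta> = "dual_to_primal P s lam z - prox lam s"
      have "0 \<le> lam / 2 * (?\<delta> \<bullet> ?\<delta>)"
        using lam scalar_prod_self_nonneg[of ?\<delta>] by simp
      then show ?thesis
        using prox_dist_le_gap[OF z s lam 2] by (simp add: dual_objective_eq 2)
    qed (simp add: dual_objective_eq)
  qed
qed

section \<open>Dual gap and primal error across one iteration\<close>

lemma dual_gap_eq:
  assumes "s \<in> carrier_vec d" "0 < lam"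
  shows "dual_gap P s lam y = e2ennreal (conj_sum y + ereal (dual_quad lam s y + moreau lam s))"
  unfolding dual_gap_def INF_dual_objective[OF assms] dual_objective_eq
  by (cases "conj_sum y") (auto simp: add.assoc)

text \<open>Dropping the conjugates' common part \<open>c\<close>, the change of the gap is the change of a quadratic
  plus that of the Moreau envelope, which is controlled by testing the new envelope at the old
  proximal point.\<close>

lemma gap_recenter_real:
  assumes y: "y \<in> carrier_vec n" and s: "s \<in> carrier_vec d" and lam: "0 < lam"
    and c: "conj_sum y = ereal c"
  defines "x \<equiv> dual_to_primal P s lam y"
  shows "c + dual_quad lam x y + moreau lam x
    \<le> 6 * (c + dual_quad lam s y + moreau lam s) + 3 * excess s"
proof -
  define w where "w = (data P)\<^sup>T *\<^sub>v y"
  define p where "p = prox lam s"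
  have w: "w \<in> carrier_vec d" and p: "p \<in> carrier_vec d" and x: "x \<in> carrier_vec d"
    using prox_carrier[OF s lam] s by (simp_all add: w_def p_def x_def)
  have "moreau lam x - moreau lam s \<le> lam / 2 * ((p - x) \<bullet> (p - x)) - lam / 2 * ((p - s) \<bullet> (p - s))"
    using prox_min[OF x lam p] by (simp add: moreau_def[of _ s] reg_def p_def)
  moreover have "dual_quad lam x y - dual_quad lam s y = lam * ((x - s) \<bullet> (x - s))"
    unfolding dual_quad_def x_def dual_to_primal_def w_def[symmetric] using w s lam
    by (simp add: scalar_prod_sum[of _ d] sum_distrib_left flip: sum.distrib sum_subtractf)
      (auto intro!: sum.cong simp: field_simps)
  moreover have "(x - s) \<bullet> (x - s) \<le> 2 * ((x - p) \<bullet> (x - p)) + 2 * ((p - s) \<bullet> (p - s))"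
  proof -
    have "(x - s) \<bullet> (x - s) \<le> (\<Sum>j<d. 2 * (x $ j - p $ j)\<^sup>2 + 2 * (p $ j - s $ j)\<^sup>2)"
      using x s
    proof (simp add: scalar_prod_sum[of _ d], intro sum_mono)
      fix j
      have "2 * (x $ j - p $ j)\<^sup>2 + 2 * (p $ j - s $ j)\<^sup>2 - (x $ j - s $ j) * (x $ j - s $ j)
        = (x $ j + s $ j - 2 * p $ j)\<^sup>2"
        by (simp add: power2_eq_square algebra_simps)
      also have "\<dots> \<ge> 0" by simp
      finally show "(x $ j - s $ j) * (x $ j - s $ j) \<le> 2 * (x $ j - p $ j)\<^sup>2 + 2 * (p $ j - s $ j)\<^sup>2"
        by simp
    qed
    also have "\<dots> = 2 * ((x - p) \<bullet> (x - p)) + 2 * ((p - s) \<bullet> (p - s))"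
      using x p s by (simp add: scalar_prod_sum[of _ d] sum_distrib_left sum.distrib power2_eq_square)
    finally show ?thesis .
  qed
  then have "lam * ((x - s) \<bullet> (x - s)) \<le> lam * (2 * ((x - p) \<bullet> (x - p)) + 2 * ((p - s) \<bullet> (p - s)))"
    using lam by (intro mult_left_mono) auto
  moreover have "(p - x) \<bullet> (p - x) = (x - p) \<bullet> (x - p)"
    using p x by (simp add: scalar_prod_sum[of _ d] algebra_simps)
  moreover have "lam / 2 * ((x - p) \<bullet> (x - p)) \<le> c + dual_quad lam s y + moreau lam s"
    using prox_dist_le_gap[OF y s lam c] by (simp add: x_def p_def)
  moreover have "lam / 2 * ((p - s) \<bullet> (p - s)) \<le> excess s"
    using prox_dist_le[OF s lam] by (simp add: p_def)
  \<comment> \<open>With u = (lam/2) |x - p|^2 and v = (lam/2) |p - s|^2, the quadratic grows by at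
    most 4u + 4v and the envelope by at most u - v, in total 5u + 3v; u is at most the old gap and v
    at most the old error.\<close>
  ultimately show ?thesis
    by (simp add: algebra_simps)
qed

text \<open>Expand F around the proximal point p by smoothness. The linear term is split by Young's
  inequality: one half completes F(p) to the Moreau envelope, which has halved the error, and the
  other half joins the smoothness term as a multiple of |h|^2, bounded by the gap.\<close>

lemma excess_step_real:
  assumes y: "y \<in> carrier_vec n" and s: "s \<in> carrier_vec d" and c: "conj_sum y = ereal c"
  shows "excess (dual_to_primal P s \<mu> y)
    \<le> excess s / 2 + (1 + \<beta> / \<mu>) * (c + dual_quad \<mu> s y + moreau \<mu> s)"
proof -
  define x where "x = dual_to_primal P s \<mu> y"
  define p where "p = prox \<mu> s"
  have p: "p \<in> carrier_vec d" and x: "x \<in> carrier_vec d"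
    using prox_carrier[OF s mu_pos] s by (simp_all add: p_def x_def)
  define h where "h = x - p"
  have h: "h \<in> carrier_vec d"
    using x p by (simp add: h_def)
  have "x = p + h"
    unfolding h_def using x p by (intro eq_vecI) auto
  then have "F x \<le> F p + grad p \<bullet> h + \<beta> / 2 * (h \<bullet> h)"
    using objective_upper[OF p h] by simp
  moreover have "grad p \<bullet> h \<le> \<mu> / 2 * ((p - s) \<bullet> (p - s)) + \<mu> / 2 * (h \<bullet> h)"
  proof -
    \<comment> \<open>Young's inequality as an expanded square, since \<open>grad p\<close> equals
      \<mu> (s - p).\<close>
    have "0 \<le> \<mu> / 2 * ((s - p - h) \<bullet> (s - p - h))"
      using mu_pos scalar_prod_self_nonneg[of "s - p - h"] by simp
    also have "\<dots> = \<mu> / 2 * ((p - s) \<bullet> (p - s)) + \<mu> / 2 * (h \<bullet> h) - grad p \<bullet> h"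
      unfolding prox_grad[OF s mu_pos, folded p_def] using p s h
      by (simp add: scalar_prod_sum[of _ d] sum_distrib_left flip: sum.distrib sum_subtractf)
        (auto intro!: sum.cong simp: field_simps)
    finally show ?thesis by simp
  qed
  moreover have "F p + \<mu> / 2 * ((p - s) \<bullet> (p - s)) - min_objective P \<le> excess s / 2"
    using moreau_contraction[OF s] by (simp add: moreau_def reg_def p_def)
  moreover have "\<mu> / 2 * (h \<bullet> h) + \<beta> / 2 * (h \<bullet> h) = (1 + \<beta> / \<mu>) * (\<mu> / 2 * (h \<bullet> h))"
    using mu_pos by (simp add: field_simps)
  moreover have "(1 + \<beta> / \<mu>) * (\<mu> / 2 * (h \<bullet> h)) \<le> (1 + \<beta> / \<mu>) * (c + dual_quad \<mu> s y + moreau \<mu> s)"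
    using prox_dist_le_gap[OF y s mu_pos c] \<beta>_pos mu_pos
    by (intro mult_left_mono) (auto simp: h_def x_def p_def)
  ultimately show ?thesis
    unfolding excess_def x_def[symmetric] by argo
qed

text \<open>At the dual image of \<open>s\<close> the gap equals |grad s|^2 / (2 lam) plus the
  envelope minus F(s). The envelope is at most F(s), and \<open>grad_sq_le\<close> bounds the
  rest.\<close>

lemma dual_gap_initial:
  assumes s: "s \<in> carrier_vec d" and lam: "0 < lam"
  shows "dual_gap P s lam (primal_to_dual P s) \<le> ennreal (\<beta> / lam * excess s)"
proof -
  have "moreau lam s \<le> F s"
    using prox_min[OF s lam s] s by (simp add: reg_def)
  moreover have "grad s \<bullet> s = s \<bullet> grad s"
    using s by (simp add: comm_scalar_prod[of _ d])
  moreover have "1 / (2 * lam) * (grad s \<bullet> grad s) \<le> 1 / (2 * lam) * (2 * \<beta> * excess s)"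
    using grad_sq_le[OF s \<beta>_pos] lam by (intro mult_left_mono) auto
  ultimately have "grad s \<bullet> s - F s + dual_quad lam s (primal_to_dual P s) + moreau lam s \<le> \<beta> / lam * excess s"
    unfolding dual_quad_def grad_def[symmetric] by simp
  then show ?thesis
    by (simp add: dual_gap_eq[OF s lam] conj_sum_primal_to_dual[OF s] ennreal_leI add.assoc)
qed

section \<open>The potential and its expected contraction\<close>

lemma gap_cases:
  assumes y: "y \<in> carrier_vec n" and s: "s \<in> carrier_vec d" and lam: "0 < lam"
  obtains "dual_gap P s lam y = \<top>"
    | c where "conj_sum y = ereal c" "0 \<le> c + dual_quad lam s y + moreau lam s"
        "dual_gap P s lam y = ennreal (c + dual_quad lam s y + moreau lam s)"
  using y
proof (cases rule: conj_sum_cases)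
  case 1
  then show thesis
    by (intro that(1)) (simp add: dual_gap_eq[OF s lam])
next
  case (2 c)
  let ?\<delta> = "dual_to_primal P s lam y - prox lam s"
  have "0 \<le> lam / 2 * (?\<delta> \<bullet> ?\<delta>)"
    using lam scalar_prod_self_nonneg[of ?\<delta>] by simp
  then show thesis
    using prox_dist_le_gap[OF y s lam 2] 2
    by (intro that(2)) (auto simp: dual_gap_eq[OF s lam] add.assoc)
qed

text \<open>The weight 1/16 keeps the error fed back by recentring small: the error coefficient
  after a step is 1/2 + 3/16 = 11/16, below 3/4. The gap coefficient is 1 + \<beta>/\<mu> + 6/16 =
  11/8 + \<beta>/\<mu>.\<close>

definition potential :: "real vec \<times> real vec \<Rightarrow> ennreal" where
  "potential = (\<lambda>(x, y). ennreal (excess x) + ennreal (1 / 16) * dual_gap P x \<mu> y)"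

lemma potential_step:
  assumes y: "y \<in> carrier_vec n" and s: "s \<in> carrier_vec d"
  shows "potential (dual_to_primal P s \<mu> y, y)
    \<le> ennreal (11 / 16 * excess s) + ennreal (11 / 8 + \<beta> / \<mu>) * dual_gap P s \<mu> y"
  using y s mu_pos
proof (cases rule: gap_cases)
  \<comment> \<open>An infinite gap makes the right side infinite, because its coefficient is
    positive.\<close>
  case 1
  moreover have "0 < 11 / 8 + \<beta> / \<mu>"
    using \<beta>_pos mu_pos by (simp add: add_pos_pos)
  ultimately show ?thesis
    by (simp add: ennreal_mult_top)
next
  case (2 c)
  define x where "x = dual_to_primal P s \<mu> y"
  have x: "x \<in> carrier_vec d"
    using s by (simp add: x_def)
  define \<gamma> where "\<gamma> = c + dual_quad \<mu> s y + moreau \<mu> s"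
  have "dual_gap P x \<mu> y = ennreal (c + dual_quad \<mu> x y + moreau \<mu> x)"
    by (simp add: dual_gap_eq[OF x mu_pos] 2 add.assoc)
  also have "\<dots> \<le> ennreal (6 * \<gamma> + 3 * excess s)"
    using gap_recenter_real[OF y s mu_pos 2(1)] by (intro ennreal_leI) (simp add: x_def \<gamma>_def)
  finally have "ennreal (1 / 16) * dual_gap P x \<mu> y \<le> ennreal (1 / 16) * ennreal (6 * \<gamma> + 3 * excess s)"
    by (intro mult_left_mono) auto
  moreover have "ennreal (excess x) \<le> ennreal (excess s / 2 + (1 + \<beta> / \<mu>) * \<gamma>)"
    using excess_step_real[OF y s 2(1)] by (intro ennreal_leI) (simp add: x_def \<gamma>_def)
  ultimately have "potential (x, y)
      \<le> ennreal (excess s / 2 + (1 + \<beta> / \<mu>) * \<gamma>) + ennreal (1 / 16) * ennreal (6 * \<gamma> + 3 * excess s)"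
    unfolding potential_def by (auto intro: add_mono)
  also have "\<dots> = ennreal (excess s / 2 + (1 + \<beta> / \<mu>) * \<gamma> + 1 / 16 * (6 * \<gamma> + 3 * excess s))"
    using 2(2) excess_nonneg[OF s] \<beta>_pos mu_pos
    by (subst ennreal_mult[symmetric], simp_all add: \<gamma>_def flip: ennreal_plus)
  also have "excess s / 2 + (1 + \<beta> / \<mu>) * \<gamma> + 1 / 16 * (6 * \<gamma> + 3 * excess s)
      = 11 / 16 * excess s + (11 / 8 + \<beta> / \<mu>) * \<gamma>"
    by (simp add: algebra_simps)
  also have "ennreal \<dots> = ennreal (11 / 16 * excess s) + ennreal (11 / 8 + \<beta> / \<mu>) * ennreal \<gamma>"
    using 2(2) excess_nonneg[OF s] \<beta>_pos mu_pos
    by (subst ennreal_plus) (auto simp: \<gamma>_def ennreal_mult')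
  finally show ?thesis
    by (simp add: x_def 2 \<gamma>_def)
qed

text \<open>After averaging, the oracle divides the gap coefficient of \<open>potential_step\<close>
  by \<sigma>. The constant 3/64 is 3/4 times the weight 1/16, so the gap part contracts at the rate
  3/4 too.\<close>

lemma oracle_step:
  assumes D: "dual_oracle P \<sigma> \<mu> D" and \<sigma>: "0 < \<sigma>" "11 / 8 + \<beta> / \<mu> \<le> 3 / 64 * \<sigma>"
    and y: "y \<in> carrier_vec n" and s: "s \<in> carrier_vec d"
  shows "(\<integral>\<^sup>+ r. potential (dual_to_primal P s \<mu> (fst r), fst r) \<partial>D s y) \<le> ennreal (3 / 4) * potential (s, y)"
proof -
  let ?K = "11 / 8 + \<beta> / \<mu>"
  have K: "0 \<le> ?K"
    using \<beta>_pos mu_pos by simp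
  have D': "fst ` set_pmf (D s y) \<subseteq> carrier_vec n"
    "(\<integral>\<^sup>+ r. dual_gap P s \<mu> (fst r) \<partial>D s y) \<le> ennreal (1 / \<sigma>) * dual_gap P s \<mu> y"
    using D y s unfolding dual_oracle_def by blast+
  have "(\<integral>\<^sup>+ r. potential (dual_to_primal P s \<mu> (fst r), fst r) \<partial>D s y)
      \<le> (\<integral>\<^sup>+ r. ennreal (11 / 16 * excess s) + ennreal ?K * dual_gap P s \<mu> (fst r) \<partial>D s y)"
    using potential_step[OF _ s] D'(1) by (intro nn_integral_mono_AE AE_pmfI) blast
  also have "\<dots> = ennreal (11 / 16 * excess s) + ennreal ?K * (\<integral>\<^sup>+ r. dual_gap P s \<mu> (fst r) \<partial>D s y)"
    by (simp add: nn_integral_add nn_integral_cmult)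
  also have "\<dots> \<le> ennreal (11 / 16 * excess s) + ennreal ?K * (ennreal (1 / \<sigma>) * dual_gap P s \<mu> y)"
    by (intro add_left_mono mult_left_mono D'(2)) auto
  also have "\<dots> = ennreal (11 / 16 * excess s) + ennreal (?K / \<sigma>) * dual_gap P s \<mu> y"
    using K \<sigma> by (simp add: ennreal_mult' mult.assoc[symmetric] flip: ennreal_mult')
  also have "\<dots> \<le> ennreal (3 / 4 * excess s) + ennreal (3 / 4 * (1 / 16)) * dual_gap P s \<mu> y"
    using \<sigma> excess_nonneg[OF s]
    by (intro add_mono mult_right_mono ennreal_leI) (auto simp: field_simps)
  also have "\<dots> = ennreal (3 / 4) * potential (s, y)"
    unfolding potential_def
    by (simp only: ennreal_mult' prod.case distrib_left mult.assoc)
  finally show ?thesis .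
qed

lemma potential_initial:
  assumes x: "x \<in> carrier_vec d"
  shows "potential (x, primal_to_dual P x) \<le> ennreal ((1 + \<beta> / \<mu>) * excess x)"
proof -
  have "potential (x, primal_to_dual P x) \<le> ennreal (excess x) + ennreal (1 / 16) * ennreal (\<beta> / \<mu> * excess x)"
    unfolding potential_def prod.case
    by (intro add_left_mono mult_left_mono dual_gap_initial[OF x mu_pos]) auto
  also have "\<dots> = ennreal (excess x + 1 / 16 * (\<beta> / \<mu> * excess x))"
    using \<beta>_pos mu_pos excess_nonneg[OF x]
    by (subst ennreal_mult[symmetric], simp_all flip: ennreal_plus)
  also have "\<dots> \<le> ennreal ((1 + \<beta> / \<mu>) * excess x)"
    using \<beta>_pos mu_pos excess_nonneg[OF x] by (intro ennreal_leI) (auto simp: field_simps)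
  finally show ?thesis .
qed

section \<open>Expected error and worst-case time of Dual APPA\<close>

context
  fixes D :: "real vec \<Rightarrow> real vec \<Rightarrow> real vec timed" and \<sigma> :: real and x0 :: "real vec"
    and prim_time :: "nat \<Rightarrow> nat"
  assumes D: "dual_oracle P \<sigma> \<mu> D" and \<sigma>: "0 < \<sigma>" "11 / 8 + \<beta> / \<mu> \<le> 3 / 64 * \<sigma>"
    and x0: "x0 \<in> carrier_vec d"
begin

abbreviation "state \<equiv> dual_appa_state prim_time P \<mu> D x0"

lemma dual_appa_state_carrier:
  assumes "((x, y), k) \<in> set_pmf (state t)"
  shows "x \<in> carrier_vec d" "y \<in> carrier_vec n"
proof -
  have "x \<in> carrier_vec d \<and> y \<in> carrier_vec n"
    using assms
  proof (induction t arbitrary: x y k)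
    case 0
    then show ?case
      using x0 by simp
  next
    case (Suc t)
    then obtain s z i y' j where *: "((s, z), i) \<in> set_pmf (state t)" "(y', j) \<in> set_pmf (D s z)"
      "x = dual_to_primal P s \<mu> y'" "y = y'"
      by auto
    have "fst ` set_pmf (D s z) \<subseteq> carrier_vec n"
      using D Suc.IH[OF *(1)] unfolding dual_oracle_def by blast
    then show ?case
      using Suc.IH[OF *(1)] * by force
  qed
  then show "x \<in> carrier_vec d" "y \<in> carrier_vec n"
    by auto
qed

lemma dual_appa_time:
  assumes B: "\<And>s y y' k. s \<in> carrier_vec d \<Longrightarrow> y \<in> carrier_vec n \<Longrightarrow> (y', k) \<in> set_pmf (D s y) \<Longrightarrow> real k \<le> B"
    and out: "(x, k) \<in> set_pmf (dual_appa prim_time P \<mu> D x0 t)"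
  shows "real k \<le> real n * real (prim_time d) + real t * (B + (2 * real n * real d + 2 * real d + 1))"
proof -
  obtain y where "((x, y), k) \<in> set_pmf (state t)"
    using out by (auto simp: dual_appa_def)
  then show ?thesis
  proof (induction t arbitrary: x y k)
    case (Suc t)
    then obtain s z i y' j where *: "((s, z), i) \<in> set_pmf (state t)" "(y', j) \<in> set_pmf (D s z)"
      "k = i + j + (2 * n * d + 2 * d + 1)"
      by auto
    have "real j \<le> B"
      using B *(2) dual_appa_state_carrier[OF *(1)] by blast
    then show ?case
      using Suc.IH[OF *(1)] *(3) by (simp add: algebra_simps)
  qed simp
qed

text \<open>The law of the next state is a bind, so its expectation is an iterated integral;
  \<open>oracle_step\<close> bounds the inner one at every state in the support.\<close>

lemma dual_appa_state_potential:
  "(\<integral>\<^sup>+ p. potential (fst p) \<partial>state t) \<le> ennreal ((3 / 4) ^ t) * potential (x0, primal_to_dual P x0)"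
proof (induction t)
  case 0
  then show ?case by simp
next
  case (Suc t)
  have "(\<integral>\<^sup>+ p. potential (fst p) \<partial>state (Suc t)) =
      (\<integral>\<^sup>+ p. (\<integral>\<^sup>+ r. potential (dual_to_primal P (fst (fst p)) \<mu> (fst r), fst r)
        \<partial>D (fst (fst p)) (snd (fst p))) \<partial>state t)"
    by (simp add: split_beta)
  also have "\<dots> \<le> (\<integral>\<^sup>+ p. ennreal (3 / 4) * potential (fst p) \<partial>state t)"
    using oracle_step[OF D \<sigma>] dual_appa_state_carrier
    by (intro nn_integral_mono_AE) (auto simp: AE_measure_pmf_iff)
  also have "\<dots> = ennreal (3 / 4) * (\<integral>\<^sup>+ p. potential (fst p) \<partial>state t)"
    by (simp add: nn_integral_cmult)
  also have "\<dots> \<le> ennreal (3 / 4) * (ennreal ((3 / 4) ^ t) * potential (x0, primal_to_dual P x0))"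
    by (intro mult_left_mono Suc.IH) auto
  also have "\<dots> = ennreal ((3 / 4) ^ Suc t) * potential (x0, primal_to_dual P x0)"
    by (simp only: power_Suc ennreal_mult' mult.assoc)
  finally show ?case .
qed

lemma dual_appa_carrier: "fst ` set_pmf (dual_appa prim_time P \<mu> D x0 t) \<subseteq> carrier_vec d"
  using dual_appa_state_carrier by (fastforce simp: dual_appa_def)

text \<open>Discarding the gap part of the potential bounds the nonnegative integral of the error.
  Finiteness gives integrability, and the bound passes to the Bochner integral.\<close>

lemma dual_appa_expectation:
  fixes t :: nat
  defines "out \<equiv> measure_pmf (dual_appa prim_time P \<mu> D x0 t)"
  shows "integrable out (\<lambda>(x, k). F x)"
    and "(\<integral>(x, k). F x \<partial>out) - min_objective P \<le> (3 / 4) ^ t * ((1 + \<beta> / \<mu>) * excess x0)"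
proof -
  let ?b = "(3 / 4) ^ t * ((1 + \<beta> / \<mu>) * excess x0)"
  have b: "0 \<le> ?b"
    using excess_nonneg[OF x0] \<beta>_pos mu_pos by simp
  have AE: "AE r in out. 0 \<le> excess (fst r)"
    unfolding out_def AE_measure_pmf_iff using dual_appa_carrier excess_nonneg by blast
  have "(\<integral>\<^sup>+ r. ennreal (excess (fst r)) \<partial>out) = (\<integral>\<^sup>+ p. ennreal (excess (fst (fst p))) \<partial>state t)"
    unfolding out_def dual_appa_def by (simp add: split_beta)
  also have "\<dots> \<le> (\<integral>\<^sup>+ p. potential (fst p) \<partial>state t)"
    by (intro nn_integral_mono) (auto simp: potential_def split_beta)
  also have "\<dots> \<le> ennreal ((3 / 4) ^ t) * potential (x0, primal_to_dual P x0)"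
    by (rule dual_appa_state_potential)
  also have "\<dots> \<le> ennreal ((3 / 4) ^ t) * ennreal ((1 + \<beta> / \<mu>) * excess x0)"
    by (intro mult_left_mono potential_initial[OF x0]) auto
  also have "\<dots> = ennreal ?b"
    by (simp add: ennreal_mult')
  finally have le: "(\<integral>\<^sup>+ r. ennreal (excess (fst r)) \<partial>out) \<le> ennreal ?b" .
  have int: "integrable out (\<lambda>r. excess (fst r))"
    using AE le by (intro integrableI_nonneg) (auto simp: out_def intro: le_less_trans)
  have "ennreal (\<integral>r. excess (fst r) \<partial>out) \<le> ennreal ?b"
    using nn_integral_eq_integral[OF int AE] le by simp
  then have le': "(\<integral>r. excess (fst r) \<partial>out) \<le> ?b"
    using b by (simp add: ennreal_le_iff)
  have eq: "(\<lambda>(x, k). F x) = (\<lambda>r. excess (fst r) + min_objective P)"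
    by (auto simp: excess_def)
  show "integrable out (\<lambda>(x, k). F x)"
    unfolding eq using int by (intro Bochner_Integration.integrable_add) (auto simp: out_def)
  have "(\<integral>(x, k). F x \<partial>out) = (\<integral>r. excess (fst r) \<partial>out) + min_objective P"
    unfolding eq using int by (subst Bochner_Integration.integral_add) (auto simp: out_def)
  then show "(\<integral>(x, k). F x \<partial>out) - min_objective P \<le> ?b"
    using le' by simp
qed

end

section \<open>Size of the oracle quality and the hidden logarithmic factors\<close>

definition \<kappa> :: real where
  "\<kappa> = of_int (kappa P)"

definition pl :: real where
  "pl = polylog_base P \<mu>"

lemma \<kappa>_ge_1: "1 \<le> \<kappa>"
proof -
  have "0 < smoothness P * (radius P)\<^sup>2 / \<mu>"
    using L_pos mu_pos radius_pos by simp
  then have "1 \<le> kappa P"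
    unfolding kappa_def by linarith
  then show ?thesis
    by (simp add: \<kappa>_def)
qed

lemma n_ge_1: "1 \<le> real n" and d_ge_1: "1 \<le> real d"
  using n_pos d_pos by simp_all

lemma n\<kappa>_ge_1: "1 \<le> real n * \<kappa>"
  using mult_mono[OF n_ge_1 \<kappa>_ge_1] n_ge_1 by simp

lemma \<beta>_div_mu_le: "\<beta> / \<mu> \<le> real n * \<kappa>"
proof -
  have "smoothness P * (radius P)\<^sup>2 / \<mu> \<le> \<kappa>"
    unfolding \<kappa>_def kappa_def by (rule le_of_int_ceiling)
  then have "real n * (smoothness P * (radius P)\<^sup>2 / \<mu>) \<le> real n * \<kappa>"
    by (intro mult_left_mono) auto
  then show ?thesis
    by (simp add: \<beta>_def mult.assoc)
qed

text \<open>At lam = \<mu> both condition numbers coincide and the ceiling of lam/\<mu> is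
  1.\<close>

lemma appa_sigma_mu: "appa_sigma P \<mu> = 80 * real n ^ 2 * \<kappa> ^ 3"
  using mu_pos by (simp add: appa_sigma_def kappa_reg_def kappa_def \<kappa>_def power2_eq_square power3_eq_cube)

lemma appa_sigma_ge: "80 * (real n * \<kappa>) \<le> appa_sigma P \<mu>"
proof -
  have "1 * 1 \<le> real n * \<kappa> * \<kappa>"
    using n\<kappa>_ge_1 \<kappa>_ge_1 by (intro mult_mono) auto
  then have "80 * (real n * \<kappa>) * 1 \<le> 80 * (real n * \<kappa>) * (real n * \<kappa> * \<kappa>)"
    using n\<kappa>_ge_1 by (intro mult_left_mono) auto
  then show ?thesis
    by (simp add: appa_sigma_mu power2_eq_square power3_eq_cube mult_ac)
qed

lemma ln_n_nonneg: "0 \<le> ln (real n)"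
  using n_ge_1 by simp

lemma pl_ge_1: "1 \<le> pl"
  using ln_n_nonneg by (simp add: pl_def polylog_base_def)

lemma ln_n\<kappa>_le: "ln (real n) + ln \<kappa> \<le> 2 * pl"
proof -
  define q where "q = smoothness P * (radius P)\<^sup>2 / \<mu>"
  have q: "0 < q"
    using L_pos mu_pos radius_pos by (simp add: q_def)
  have "\<kappa> \<le> q + 1"
    unfolding \<kappa>_def kappa_def q_def by linarith
  \<comment> \<open>The absolute value covers q < 1 as well as q \<ge> 1, so both \<open>q\<close>
    and 1 are at most exp |ln q|.\<close>
  also have "\<dots> \<le> exp \<bar>ln q\<bar> + exp \<bar>ln q\<bar>"
    using q exp_le_cancel_iff[of "ln q" "\<bar>ln q\<bar>"] by (intro add_mono) auto
  finally have "\<kappa> \<le> 2 * exp \<bar>ln q\<bar>"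
    by simp
  then have "ln \<kappa> \<le> ln (2 * exp \<bar>ln q\<bar>)"
    using \<kappa>_ge_1 by (intro ln_mono) auto
  also have "\<dots> = ln 2 + \<bar>ln q\<bar>"
    by (simp add: ln_mult)
  also have "\<dots> \<le> 1 + (\<bar>ln (smoothness P)\<bar> + 2 * \<bar>ln (radius P)\<bar> + \<bar>ln \<mu>\<bar>)"
    using ln_2_less_1 L_pos mu_pos radius_pos by (simp add: q_def ln_div ln_mult ln_realpow)
  finally show ?thesis
    unfolding pl_def polylog_base_def using ln_n_nonneg by argo
qed

lemma log1_appa_sigma_le: "log1 (appa_sigma P \<mu>) \<le> 13 * pl"
proof -
  \<comment> \<open>80 \<le> 2^7 and ln 2 < 1 give 7; with ln n + ln \<kappa> \<le> 2
    \<open>pl\<close> and \<open>pl\<close> \<ge> 1 the total is 7 + 6 \<open>pl\<close> \<le> 13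
    \<open>pl\<close>.\<close>
  have "ln (80 :: real) \<le> ln (2 ^ 7)"
    by (intro ln_mono) auto
  also have "\<dots> \<le> 7"
    using ln_2_less_1 by (simp only: ln_realpow)
  finally have ln80: "ln (80 :: real) \<le> 7" .
  have "ln (appa_sigma P \<mu>) = ln 80 + 2 * ln (real n) + 3 * ln \<kappa>"
    using n_ge_1 \<kappa>_ge_1 by (simp add: appa_sigma_mu ln_mult ln_realpow)
  also have "\<dots> \<le> 7 + 3 * (ln (real n) + ln \<kappa>)"
    using ln80 ln_n_nonneg by argo
  also have "\<dots> \<le> 13 * pl"
    using ln_n\<kappa>_le pl_ge_1 by simp
  finally show ?thesis
    using pl_ge_1 by (simp add: log1_def)
qed

lemma ln_one_plus_n\<kappa>_le: "ln (1 + real n * \<kappa>) \<le> 3 * pl"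
proof -
  have "ln (1 + real n * \<kappa>) \<le> ln (2 * (real n * \<kappa>))"
    using n\<kappa>_ge_1 by (intro ln_mono) linarith+
  also have "\<dots> = ln 2 + (ln (real n) + ln \<kappa>)"
    using n_ge_1 \<kappa>_ge_1 by (simp add: ln_mult)
  also have "\<dots> \<le> 3 * pl"
    using ln_n\<kappa>_le ln_2_less_1 pl_ge_1 by linarith
  finally show ?thesis .
qed

end

section \<open>Number of iterations and a uniform bound for primitive costs\<close>

definition appa_iterations :: "nat \<Rightarrow> real \<Rightarrow> real \<Rightarrow> real \<Rightarrow> real \<Rightarrow> nat" where
  "appa_iterations n L \<mu> R r = nat \<lceil>4 * (ln (1 + real n * of_int \<lceil>L * R\<^sup>2 / \<mu>\<rceil>) + log1 r)\<rceil>"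

lemma log1_ge_1: "1 \<le> log1 r"
  by (simp add: log1_def)

text \<open>Since 3/4 \<le> exp(-1/4), the factor 4 in the iteration count turns (3/4)^T into at
  most exp(-l)/N. The 1/N cancels the initial factor 1 + K, and exp(-l) \<le> \<epsilon>/e.\<close>

lemma appa_iterations_suffice:
  assumes "0 \<le> K" "K \<le> real n * of_int \<lceil>L * R\<^sup>2 / \<mu>\<rceil>" "0 \<le> e" "0 < \<epsilon>"
  shows "(3 / 4) ^ appa_iterations n L \<mu> R (e / \<epsilon>) * ((1 + K) * e) \<le> \<epsilon>"
proof -
  define N where "N = 1 + real n * of_int \<lceil>L * R\<^sup>2 / \<mu>\<rceil>"
  define l where "l = log1 (e / \<epsilon>)"
  define T where "T = appa_iterations n L \<mu> R (e / \<epsilon>)"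
  have N: "1 + K \<le> N" "0 < N"
    using assms by (auto simp: N_def)
  have T: "4 * (ln N + l) \<le> real T"
    unfolding T_def appa_iterations_def N_def l_def by linarith
  have "(3 / 4 :: real) ^ T \<le> exp (- 1 / 4) ^ T"
    using exp_ge_add_one_self[of "- 1 / 4 :: real"] by (intro power_mono) auto
  also have "\<dots> = exp (- real T / 4)"
    by (simp flip: exp_of_nat_mult)
  also have "\<dots> \<le> exp (- (ln N + l))"
    using T by simp
  also have "\<dots> = exp (- l) / N"
    using N by (simp add: exp_diff exp_minus divide_inverse mult.commute)
  finally have "(3 / 4) ^ T * ((1 + K) * e) \<le> exp (- l) / N * (N * e)"
    using assms N by (intro mult_mono mult_right_mono) auto
  also have "\<dots> = exp (- l) * e"
    using N by simp
  also have "\<dots> \<le> \<epsilon>"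
  \<comment> \<open>The logarithm of e/\<epsilon> is informative only for positive \<open>e\<close>;
    for e = 0 the product is 0.\<close>
  proof (cases "e = 0")
    case False
    then have "exp (- l) \<le> exp (- ln (e / \<epsilon>))"
      by (simp add: l_def log1_def)
    also have "\<dots> = \<epsilon> / e"
      using False assms by (simp add: exp_minus)
    finally show ?thesis
      using False assms by (simp add: field_simps)
  qed (use assms in simp)
  finally show ?thesis
    by (simp add: T_def)
qed

text \<open>The finitely many values below the asymptotic threshold are absorbed by adding their sum
  to the constant; d \<ge> 1 allows a multiplication by d.\<close>

lemma bigo_nat_linear_bound:
  fixes f :: "nat \<Rightarrow> nat"
  assumes "(\<lambda>d. real (f d)) \<in> O(\<lambda>d. real d)"
  obtains c where "0 \<le> c" "\<And>d. 1 \<le> d \<Longrightarrow> real (f d) \<le> c * real d"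
proof -
  obtain c where c: "0 < c" "eventually (\<lambda>d. norm (real (f d)) \<le> c * norm (real d)) at_top"
    using assms by (rule landau_o.bigE)
  then obtain N where N: "\<And>d. N \<le> d \<Longrightarrow> real (f d) \<le> c * real d"
    by (auto simp: eventually_at_top_linorder)
  show thesis
  proof (rule that)
    show "0 \<le> c + (\<Sum>i<N. real (f i))"
      using c by (simp add: sum_nonneg)
  next
    fix d :: nat assume d: "1 \<le> d"
    show "real (f d) \<le> (c + (\<Sum>i<N. real (f i))) * real d"
    proof (cases "N \<le> d")
      case True
      have "c * real d \<le> (c + (\<Sum>i<N. real (f i))) * real d"
        by (intro mult_right_mono) (auto simp: sum_nonneg)
      with N[OF True] show ?thesis by linarith
    next
      case False
      then have "real (f d) \<le> (\<Sum>i<N. real (f i))"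
        by (intro member_le_sum) auto
      also have "\<dots> \<le> c + (\<Sum>i<N. real (f i))"
        using c by simp
      also have "\<dots> \<le> (c + (\<Sum>i<N. real (f i))) * real d"
        using d c mult_left_mono[of 1 "real d" "c + (\<Sum>i<N. real (f i))"] by (simp add: sum_nonneg)
      finally show ?thesis .
    qed
  qed
qed

section \<open>Instantiation with APCG\<close>

theorem corollary4p4:
  fixes prim_time :: "nat \<Rightarrow> nat"
    and APCG :: "erm \<Rightarrow> real \<Rightarrow> real \<Rightarrow> real vec \<Rightarrow> real vec \<Rightarrow> real vec timed"
  assumes "(\<lambda>d. real (prim_time d)) \<in> O(\<lambda>d. real d)"
    and "apcg_guarantee APCG"
  shows "\<exists>(C :: real) (k :: nat) (T :: nat \<Rightarrow> real \<Rightarrow> real \<Rightarrow> real \<Rightarrow> real \<Rightarrow> nat).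
    \<forall>P x0 \<epsilon>. erm_problem P \<and> x0 \<in> carrier_vec (d_of P) \<and> 0 < \<epsilon> \<longrightarrow>
      (let \<mu> = strong_convexity P;
           \<epsilon>0 = objective P x0 - min_objective P;
           output = dual_appa prim_time P \<mu> (APCG P (appa_sigma P \<mu>) \<mu>) x0
             (T (n_of P) (smoothness P) \<mu> (radius P) (\<epsilon>0 / \<epsilon>))
       in fst ` set_pmf output \<subseteq> carrier_vec (d_of P) \<and>
          integrable (measure_pmf output) (\<lambda>(x, t). objective P x) \<and>
          measure_pmf.expectation output (\<lambda>(x, t). objective P x) - min_objective P \<le> \<epsilon> \<and>
          (\<forall>(x, t)\<in>set_pmf output.
             real t \<le> C * polylog_base P \<mu> ^ k *
               (real (n_of P) * real (d_of P) * sqrt (of_int (kappa P)) * log1 (\<epsilon>0 / \<epsilon>))))"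
proof -
  obtain c where c: "0 \<le> c" "\<And>d. 1 \<le> d \<Longrightarrow> real (prim_time d) \<le> c * real d"
    using bigo_nat_linear_bound[OF assms(1)] by blast
  obtain C1 k1 where APCG_time: "\<And>P c lam s y y' t. erm_problem P \<Longrightarrow> 1 < c \<Longrightarrow> 0 < lam \<Longrightarrow>
      s \<in> carrier_vec (d_of P) \<Longrightarrow> y \<in> carrier_vec (n_of P) \<Longrightarrow> (y', t) \<in> set_pmf (APCG P c lam s y) \<Longrightarrow>
      real t \<le> C1 * polylog_base P lam ^ k1 *
        (real (n_of P) * real (d_of P) * sqrt (of_int (kappa_reg P lam)) * log1 c)"
    using assms(2) unfolding apcg_guarantee_def by fast
  have APCG_oracle: "\<And>P c lam. erm_problem P \<Longrightarrow> 1 < c \<Longrightarrow> 0 < lam \<Longrightarrow> dual_oracle P c lam (APCG P c lam)"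
    using assms(2) unfolding apcg_guarantee_def by blast
  show ?thesis
  \<comment> \<open>\<open>c\<close> pays for the initial dual point and 17 for the iteration count;
    per iteration, 13 |C1| pays for the oracle call and 5 for the 2nd + 2d + 1 operations of the
    primal map. Beyond \<open>k1\<close>, one power of the logarithmic base comes from log \<sigma>
    and one from the iteration count.\<close>
  proof (rule exI[of _ "c + 17 * (13 * \<bar>C1\<bar> + 5)"], rule exI[of _ "k1 + 2"], rule exI[of _ appa_iterations],
      intro allI impI, elim conjE)
    fix P and x0 :: "real vec" and \<epsilon> :: real
    assume P: "erm_problem P" and x0: "x0 \<in> carrier_vec (d_of P)" and \<epsilon>: "0 < \<epsilon>"
    interpret erm_analysis P
      by unfold_locales (rule P)
    define \<sigma> where "\<sigma> = appa_sigma P \<mu>"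
    define l where "l = log1 (excess x0 / \<epsilon>)"
    define T where "T = appa_iterations n (smoothness P) \<mu> (radius P) (excess x0 / \<epsilon>)"
    have \<sigma>_ge: "80 * (real n * \<kappa>) \<le> \<sigma>"
      unfolding \<sigma>_def by (rule appa_sigma_ge)
    \<comment> \<open>As \<beta>/\<mu> \<le> n\<kappa> and n\<kappa> \<ge> 1, the left side of the
      third claim is at most (19/8) n\<kappa>, while (3/64) \<sigma> \<ge> (15/4) n\<kappa>.\<close>
    then have \<sigma>: "1 < \<sigma>" "0 < \<sigma>" "11 / 8 + \<beta> / \<mu> \<le> 3 / 64 * \<sigma>"
      using n\<kappa>_ge_1 \<beta>_div_mu_le by linarith+
    note D = APCG_oracle[OF P \<sigma>(1) mu_pos]
    note D_ctx = D \<sigma>(2,3) x0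
    have \<kappa>_reg: "of_int (kappa_reg P \<mu>) = \<kappa>"
      by (simp add: \<kappa>_def kappa_reg_def kappa_def)
    define M where "M = real n * real d * sqrt \<kappa>"
    have sqrt\<kappa>: "1 \<le> sqrt \<kappa>"
      using \<kappa>_ge_1 by simp
    have nd: "1 \<le> real n * real d"
      using mult_mono[OF n_ge_1 d_ge_1] by simp
    have M: "real n * real d \<le> M"
      unfolding M_def using mult_left_mono[OF sqrt\<kappa>, of "real n * real d"] by simp
    have l: "1 \<le> l"
      unfolding l_def by (rule log1_ge_1)
    define B where "B = 13 * \<bar>C1\<bar> * pl ^ (k1 + 1) * M"
    have T_eq: "T = nat \<lceil>4 * (ln (1 + real n * \<kappa>) + l)\<rceil>"
      by (simp add: T_def appa_iterations_def \<kappa>_def kappa_def l_def)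
    have "0 \<le> ln (1 + real n * \<kappa>)"
      using n\<kappa>_ge_1 by simp
    then have "0 \<le> 4 * (ln (1 + real n * \<kappa>) + l)"
      using l by simp
    then have "real T \<le> 4 * (ln (1 + real n * \<kappa>) + l) + 1"
      unfolding T_eq by linarith
    also have "\<dots> \<le> 4 * (3 * pl + l) + 1"
      using ln_one_plus_n\<kappa>_le by simp
    \<comment> \<open>12 + 4 + 1 = 17, since \<open>pl\<close>, \<open>l\<close> and 1 are all at
      most \<open>pl * l\<close>.\<close>
    also have "\<dots> \<le> 17 * (pl * l)"
    proof -
      have "pl \<le> pl * l" "l \<le> pl * l"
        using pl_ge_1 l by simp_all
      then show ?thesis
        using l by argo
    qed
    finally have T_le: "real T \<le> 17 * (pl * l)" .
    have B_bound: "real t \<le> B"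
      if "s \<in> carrier_vec d" "y \<in> carrier_vec n" "(y', t) \<in> set_pmf (APCG P \<sigma> \<mu> s y)" for s y y' t
    proof -
      have "real t \<le> C1 * pl ^ k1 * (M * log1 \<sigma>)"
        using APCG_time[OF P \<sigma>(1) mu_pos that] by (simp add: \<kappa>_reg pl_def M_def)
      also have "\<dots> \<le> \<bar>C1\<bar> * pl ^ k1 * (M * (13 * pl))"
        using log1_appa_sigma_le log1_ge_1[of \<sigma>] pl_ge_1 M nd
        by (intro mult_mono) (auto simp: \<sigma>_def)
      finally show ?thesis
        by (simp add: B_def mult_ac)
    qed
    have time: "real t \<le> (c + 17 * (13 * \<bar>C1\<bar> + 5)) * pl ^ (k1 + 2) * (M * l)"
      if "(x, t) \<in> set_pmf (dual_appa prim_time P \<mu> (APCG P \<sigma> \<mu>) x0 T)" for x t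
    proof -
      have M0: "0 \<le> M" using M nd by linarith
      have pow: "1 \<le> pl ^ (k1 + 1)" "1 \<le> pl ^ (k1 + 2)"
        using pl_ge_1 by (auto intro: one_le_power simp del: power_Suc)
      have "real n * real (prim_time d) \<le> real n * (c * real d)"
        using d_ge_1 by (intro mult_left_mono c(2)) auto
      also have "\<dots> = c * (real n * real d)"
        by simp
      also have "\<dots> \<le> c * M"
        using M c(1) by (rule mult_left_mono)
      finally have prim: "real n * real (prim_time d) \<le> c * M" .
      have "real d \<le> real n * real d"
        using mult_right_mono[OF n_ge_1, of "real d"] by simp
      then have "B + (2 * real n * real d + 2 * real d + 1) \<le> B + 5 * M"
        using M nd by linarith
      moreover have "0 \<le> B"
        using M0 pl_ge_1 by (simp add: B_def)
      ultimately have iter: "real T * (B + (2 * real n * real d + 2 * real d + 1)) \<le> 17 * (pl * l) * (B + 5 * M)"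
        using T_le pl_ge_1 l by (intro mult_mono) auto
      have "real t \<le> real n * real (prim_time d) + real T * (B + (2 * real n * real d + 2 * real d + 1))"
        by (rule dual_appa_time[OF D_ctx B_bound that])
      also have "\<dots> \<le> c * M + 17 * (pl * l) * (B + 5 * M)"
        using prim iter by (rule add_mono)
      also have "\<dots> \<le> c * (pl ^ (k1 + 2) * (M * l))
          + 17 * (pl * l) * (13 * \<bar>C1\<bar> * pl ^ (k1 + 1) * M + 5 * (pl ^ (k1 + 1) * M))"
      proof (intro add_mono mult_left_mono)
        have "1 * (M * 1) \<le> pl ^ (k1 + 2) * (M * l)"
          using pow l M0 by (intro mult_mono) auto
        then show "M \<le> pl ^ (k1 + 2) * (M * l)"
          by simp
        show "M \<le> pl ^ (k1 + 1) * M"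
          using mult_right_mono[OF pow(1) M0] by simp
      qed (use c pl_ge_1 l in \<open>auto simp: B_def\<close>)
      also have "\<dots> = (c + 17 * (13 * \<bar>C1\<bar> + 5)) * pl ^ (k1 + 2) * (M * l)"
        by (simp add: algebra_simps)
      finally show ?thesis .
    qed
    have "(3 / 4) ^ T * ((1 + \<beta> / \<mu>) * excess x0) \<le> \<epsilon>"
      unfolding T_def using \<beta>_pos mu_pos \<beta>_div_mu_le excess_nonneg[OF x0] \<epsilon>
      by (intro appa_iterations_suffice) (auto simp: \<kappa>_def kappa_def)
    note expectation = order_trans[OF dual_appa_expectation(2)[OF D_ctx] this]
    show "let \<mu> = strong_convexity P;
           \<epsilon>0 = objective P x0 - min_objective P;
           output = dual_appa prim_time P \<mu> (APCG P (appa_sigma P \<mu>) \<mu>) x0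
             (appa_iterations (n_of P) (smoothness P) \<mu> (radius P) (\<epsilon>0 / \<epsilon>))
       in fst ` set_pmf output \<subseteq> carrier_vec (d_of P) \<and>
          integrable (measure_pmf output) (\<lambda>(x, t). objective P x) \<and>
          measure_pmf.expectation output (\<lambda>(x, t). objective P x) - min_objective P \<le> \<epsilon> \<and>
          (\<forall>(x, t)\<in>set_pmf output.
             real t \<le> (c + 17 * (13 * \<bar>C1\<bar> + 5)) * polylog_base P \<mu> ^ (k1 + 2) *
               (real (n_of P) * real (d_of P) * sqrt (of_int (kappa P)) * log1 (\<epsilon>0 / \<epsilon>)))"
      unfolding Let_def excess_def[symmetric] \<sigma>_def[symmetric] T_def[symmetric] l_def[symmetric]
        pl_def[symmetric] \<kappa>_def[symmetric] M_def[symmetric]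
      using dual_appa_carrier[OF D_ctx] dual_appa_expectation(1)[OF D_ctx] expectation time by blast
  qed
qed

end
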